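(* Let $p$ be a prime. For all $r,m\in\mathbb{N}$, writing $T_r^{\times m}=T_r\times\dots\times T_r$ for the $m$-fold Cartesian power, $$\mathsf{d}_{T_r^{\times m},p}(s)\big|_{p\to p^{-1}}=(-1)^{rm}\,p^{m\binom{r+1}{2}-r-rs}\;\mathsf{d}_{T_r^{\times m},p}(s).$$ If $\lambda=(\lambda_1,\dots,\lambda_m)$ is a partition (with $\lambda_1\ge\dots\ge\lambda_m\ge1$) which is not a rectangle, then $\mathsf{d}_{T_\lambda,p}(s)$ does not satisfy a functional equation of the form $$\mathsf{d}_{T_\lambda,p}(s)\big|_{p\to p^{-1}}=\pm\, p^{d_1-d_2s}\;\mathsf{d}_{T_\lambda,p}(s)$$ for $d_1,d_2\in\mathbb{N}_0$.
   Context: Orbits. For a map $T:X\to X$, a closed orbit of length $n\in\mathbb{N}=\{1,2,\dots\}$ is a set $\{x,T(x),T^2(x),\dots,T^n(x)=x\}$ of cardinality $n$. Let $\mathsf{O}_T(n)$ be the number of closed orbits of length $n$, assumed finite for all $n$. The maps $T_r$ and $T_\lambda$. For $r\in\mathbb{N}$, $T_r$ denotes a map such that $\mathsf{O}_{T_r}(n)=a_n(\mathbb{Z}^r)$ for all $n\in\mathbb{N}$, where $a_n(\mathbb{Z}^r)$ is the number of subgroups of index $n$ in $\mathbb{Z}^r$. For a partition $\lambda=(\lambda_1,\dots,\lambda_m)$, $T_\lambda=T_{\lambda_1}\times\dots\times T_{\lambda_m}$ is the Cartesian product map (acting coordinatewise); thus $T_r^{\times m}=T_{(r^m)}$ with $(r^m)=(r,\dots,r)$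 ($m$ parts). A partition is called a rectangle if it is of the form $(r^m)$, i.e. all its parts are equal. Euler factors. For a prime $p$, $\mathsf{d}_{T_\lambda,p}(s)=\sum_{k=0}^\infty \mathsf{O}_{T_\lambda}(p^k)p^{-ks}$. Inversion of the prime. There is a (unique) bivariate rational function $R_\lambda(X,Y)\in\mathbb{Q}(X,Y)$, depending only on $\lambda$, with $\mathsf{d}_{T_\lambda,p}(s)=R_\lambda(p,p^{-s})$ for all primes $p$. The operation $p\to p^{-1}$ means replacing $R_\lambda(p,p^{-s})$ by $R_\lambda(p^{-1},p^{s})$, and functional equations are understood as identities of rational functions in $p$ and $p^{-s}$: an equation $\mathsf{d}_{T_\lambda,p}(s)|_{p\to p^{-1}}=\pm p^{d_1-d_2s}\,\mathsf{d}_{T_\lambda,p}(s)$ means $R_\lambda(X^{-1},Y^{-1})=\pm X^{d_1}Y^{d_2}R_\lambda(X,Y)$ in $\mathbb{Q}(X,Y)$. $\mathbb{N}_0=\mathbb{N}\cup\{0\}$. *)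

theory Defs
  imports
    "HOL-Analysis.Complex_Transcendental"
    "HOL-Algebra.Product_Groups"
    "HOL-Computational_Algebra.Computational_Algebra"
    "HOL-Computational_Algebra.Field_as_Ring"
begin

section \<open>Closed orbits\<close>

definition closed_orbits :: "'a set \<Rightarrow> ('a \<Rightarrow> 'a) \<Rightarrow> nat \<Rightarrow> 'a set set" where
  "closed_orbits X T n =
     {C. \<exists>x\<in>X. C = (\<lambda>i. (T ^^ i) x) ` {0..n} \<and> (T ^^ n) x = x \<and> card C = n}"

definition orbit_count :: "'a set \<Rightarrow> ('a \<Rightarrow> 'a) \<Rightarrow> nat \<Rightarrow> nat" where
  "orbit_count X T n = card (closed_orbits X T n)"


section \<open>The maps \<open>T\<^sub>r\<close> and \<open>T\<^sub>\<lambda>\<close>\<close>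

definition Z_pow :: "nat \<Rightarrow> (nat \<Rightarrow> int) monoid" where
  "Z_pow r = product_group {..<r} (\<lambda>_. integer_group)"

text \<open>The index of \<open>H\<close> is the number of its cosets. Since \<open>card\<close> of an infinite set is \<open>0\<close>,
  subgroups of infinite index are not counted for any \<open>n \<ge> 1\<close>.\<close>

definition subgroup_count :: "nat \<Rightarrow> nat \<Rightarrow> nat" where
  "subgroup_count r n = card {H. subgroup H (Z_pow r) \<and> card (rcosets\<^bsub>Z_pow r\<^esub> H) = n}"

definition realises_subgroup_count :: "'a set \<Rightarrow> ('a \<Rightarrow> 'a) \<Rightarrow> nat \<Rightarrow> bool" where
  "realises_subgroup_count X T r \<longleftrightarrow>
     T \<in> X \<rightarrow> X \<and>
     (\<forall>n\<ge>1. finite (closed_orbits X T n) \<and> orbit_count X T n = subgroup_count r n)"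

definition is_partition :: "nat list \<Rightarrow> bool" where
  "is_partition lam \<longleftrightarrow> sorted_wrt (\<ge>) lam \<and> (\<forall>r\<in>set lam. 1 \<le> r)"

definition is_rectangle :: "nat list \<Rightarrow> bool" where
  "is_rectangle lam \<longleftrightarrow> (\<exists>r m. lam = replicate m r)"

text \<open>For a family of maps \<open>T r\<close> on \<open>X r\<close>, the points of the Cartesian product are the lists whose
  \<open>i\<close>-th entry lies in \<open>X (lam ! i)\<close>; the product map applies \<open>T (lam ! i)\<close> to that entry.\<close>

definition product_space :: "(nat \<Rightarrow> 'a set) \<Rightarrow> nat list \<Rightarrow> 'a list set" where
  "product_space X lam = listset (map X lam)"

definition product_map :: "(nat \<Rightarrow> 'a \<Rightarrow> 'a) \<Rightarrow> nat list \<Rightarrow> 'a list \<Rightarrow> 'a list" where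
  "product_map T lam xs = map2 T lam xs"


section \<open>Bivariate rational functions over the rationals\<close>

text \<open>The field of rational functions in \<open>X\<close> and \<open>Y\<close> is the fraction field of the polynomials
  in \<open>Y\<close> (outer variable) over the polynomials in \<open>X\<close> (inner variable).\<close>

type_synonym ratfun = "rat poly poly fract"

definition const_ratfun :: "rat \<Rightarrow> ratfun" where
  "const_ratfun a = to_fract [:[:a:]:]"

definition X_ratfun :: ratfun where
  "X_ratfun = to_fract [:[:0, 1:]:]"

definition Y_ratfun :: ratfun where
  "Y_ratfun = to_fract [:0, 1:]"

text \<open>Substitution into a bivariate polynomial; \<open>c\<close> is the embedding of the rationals into the target
  field.\<close>

definition bipoly_eval :: "(rat \<Rightarrow> 'k::field) \<Rightarrow> rat poly poly \<Rightarrow> 'k \<Rightarrow> 'k \<Rightarrow> 'k" where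
  "bipoly_eval c P x y = poly (map_poly (\<lambda>q. poly (map_poly c q) x) P) y"

text \<open>Substitution into a rational function uses the representation in lowest terms, so that
  \<open>ratfun_defined\<close> holds as soon as some representation has a denominator not vanishing at the
  point.\<close>

definition ratfun_defined :: "(rat \<Rightarrow> 'k::field) \<Rightarrow> ratfun \<Rightarrow> 'k \<Rightarrow> 'k \<Rightarrow> bool" where
  "ratfun_defined c R x y \<longleftrightarrow> bipoly_eval c (snd (quot_of_fract R)) x y \<noteq> 0"

definition ratfun_eval :: "(rat \<Rightarrow> 'k::field) \<Rightarrow> ratfun \<Rightarrow> 'k \<Rightarrow> 'k \<Rightarrow> 'k" where
  "ratfun_eval c R x y =
     bipoly_eval c (fst (quot_of_fract R)) x y / bipoly_eval c (snd (quot_of_fract R)) x y"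

text \<open>\<open>R(X\<^sup>-\<^sup>1, Y\<^sup>-\<^sup>1)\<close>: substitution of elements of the field of rational functions itself.\<close>

definition ratfun_invert :: "ratfun \<Rightarrow> ratfun" where
  "ratfun_invert R = ratfun_eval const_ratfun R (inverse X_ratfun) (inverse Y_ratfun)"


section \<open>Euler factors and their functional equations\<close>

definition euler_term :: "'a set \<Rightarrow> ('a \<Rightarrow> 'a) \<Rightarrow> nat \<Rightarrow> complex \<Rightarrow> nat \<Rightarrow> complex" where
  "euler_term X T p s k = of_nat (orbit_count X T (p ^ k)) * of_nat p powr (- of_nat k * s)"

definition euler_factor :: "'a set \<Rightarrow> ('a \<Rightarrow> 'a) \<Rightarrow> nat \<Rightarrow> complex \<Rightarrow> complex" where
  "euler_factor X T p s = (\<Sum>k. euler_term X T p s k)"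

text \<open>One rational function \<open>R\<close> has to work for all primes simultaneously; each Euler factor is
  compared with \<open>R(p, p\<^sup>-\<^sup>s)\<close> on some right half-plane on which its series converges.\<close>

definition represents_euler_factors :: "'a set \<Rightarrow> ('a \<Rightarrow> 'a) \<Rightarrow> ratfun \<Rightarrow> bool" where
  "represents_euler_factors X T R \<longleftrightarrow>
     (\<forall>p::nat. prime p \<longrightarrow>
       (\<exists>\<sigma>::real. \<forall>s::complex. Re s > \<sigma> \<longrightarrow>
          summable (euler_term X T p s) \<and>
          ratfun_defined of_rat R (of_nat p) (of_nat p powr (- s)) \<and>
          euler_factor X T p s = ratfun_eval of_rat R (of_nat p) (of_nat p powr (- s))))"

definition euler_ratfun :: "'a set \<Rightarrow> ('a \<Rightarrow> 'a) \<Rightarrow> ratfun" where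
  "euler_ratfun X T = (THE R. represents_euler_factors X T R)"

text \<open>The functional equation with sign \<open>\<epsilon>\<close> and factor \<open>p\<close> to the power \<open>d1 - d2 s\<close>, that is
  \<open>X\<close> to the power \<open>d1\<close> times \<open>Y\<close> to the power \<open>d2\<close>.\<close>

definition euler_functional_equation ::
    "'a set \<Rightarrow> ('a \<Rightarrow> 'a) \<Rightarrow> int \<Rightarrow> int \<Rightarrow> int \<Rightarrow> bool" where
  "euler_functional_equation X T \<epsilon> d1 d2 \<longleftrightarrow>
     ratfun_invert (euler_ratfun X T) =
       of_int \<epsilon> * X_ratfun powi d1 * Y_ratfun powi d2 * euler_ratfun X T"

end

theory Submission
  imports Defs
begin

text \<open>
  Let \<open>F n\<close> be the number of points fixed by the \<open>n\<close>-th iterate of a map. Sorting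
  them by the orbit they lie on gives \<open>F n = (\<Sum>d | d dvd n. d * O d)\<close> with \<open>O d\<close> the number of closed
  orbits of length \<open>d\<close>. For \<open>T r\<close> the right-hand side is the number of subgroups of index
  \<open>n\<close> in \<open>Z\<^sup>r\<^sup>+\<^sup>1\<close>: such a subgroup projects onto \<open>d Z\<close> in the last
  coordinate, meets \<open>Z\<^sup>r\<close> in a subgroup of index \<open>n / d\<close>, and is then fixed by one of \<open>n / d\<close> cosets
  (\<open>subgroups_of_index_prod_int\<close>, \<open>subgroup_count_Suc\<close>). For \<open>n = p\<^sup>k\<close> this is the Gaussian binomial
  coefficient, the product of \<open>(p\<^sup>k\<^sup>+\<^sup>j - 1) / (p\<^sup>j - 1)\<close> over \<open>1 \<le> j \<le> r\<close>
  (\<open>sum_subgroup_count_prime_powers\<close>). Fixed points of a product map are tuples of fixed points, so with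
  \<open>g(q)\<close> the product of \<open>p\<^sup>j q - 1\<close> over the parts \<open>r\<close> of \<open>lam\<close> and \<open>1 \<le> j \<le> r\<close>, the product map has
  \<open>g(p\<^sup>k) / g(1)\<close> points of period dividing \<open>p\<^sup>k\<close>. Taking differences of consecutive \<open>k\<close> recovers the orbit
  counts: with \<open>u = p\<^sup>-\<^sup>1\<^sup>-\<^sup>s\<close> the Euler factor is \<open>(1 - u) / g(1)\<close> times the sum of \<open>g(p\<^sup>k) u\<^sup>k\<close> over
  \<open>k \<ge> 0\<close>. Expanding \<open>g\<close> in powers of \<open>q\<close> turns this into finitely many geometric series, that is, into an
  explicit rational function (\<open>euler_expr\<close>, \<open>orbit_series_sums\<close>).

  Inverting \<open>p\<close> and \<open>u\<close> replaces each \<open>1 / (1 - w)\<close> by \<open>1 / (1 - 1/w) = - (w + w\<^sup>2 + \<dots>)\<close>, so the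
  inverted function is \<open>(1 - u) / h(1)\<close> times the sum of \<open>h(p\<^sup>k\<^sup>+\<^sup>1) u\<^sup>k\<close>, where \<open>h\<close> is \<open>g\<close> with \<open>p\<close>
  replaced by \<open>p\<^sup>-\<^sup>1\<close>. Here \<open>h(p\<^sup>k\<^sup>+\<^sup>1)\<close> is the product of all \<open>p\<^sup>k\<^sup>+\<^sup>1\<^sup>-\<^sup>j - 1\<close> (\<open>qpoly_inverse_sums\<close>). It vanishes for \<open>k\<close> below the largest part
  \<open>r\<close>, so the inverted series starts with \<open>u\<^sup>r\<close>. If all parts equal \<open>r\<close>, then reversing the order of the factors
  identifies the coefficient of \<open>u\<^sup>r\<^sup>+\<^sup>l\<close> with \<open>g(p\<^sup>l)\<close>, and the functional equation follows
  (\<open>euler_expr_rectangle\<close>). If not, a functional equation would make the first non-zero coefficients of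
  both series agree up to sign and a power of \<open>p\<close>. For \<open>p = 2\<close> these coefficients are products of odd
  numbers \<open>2\<^sup>r\<^sup>+\<^sup>1\<^sup>-\<^sup>j - 1\<close> and \<open>2\<^sup>j - 1\<close> over the same index set, so they would be equal; but the
  first product is strictly larger as soon as some part is smaller than \<open>r\<close>
  (\<open>euler_expr_non_rectangle\<close>).

  Identities in the field of rational functions are reduced to numerical ones: a rational function
  is determined by its values at \<open>(p, y)\<close> for all primes \<open>p\<close> and all small complex \<open>y \<noteq> 0\<close>
  (\<open>ratfun_eqI\<close>). This also yields the uniqueness of the rational function representing the Euler factors.
\<close>

section \<open>Orbits and periodic points\<close>

definition fixed_points :: "'a set \<Rightarrow> ('a \<Rightarrow> 'a) \<Rightarrow> nat \<Rightarrow> 'a set" where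
  "fixed_points X T n = {x \<in> X. (T ^^ n) x = x}"

lemma funpow_fixed_mult:
  assumes "(T ^^ n) x = x" shows "(T ^^ (n * m)) x = x"
proof (induction m)
  case (Suc m)
  have "(T ^^ (n * Suc m)) x = (T ^^ n) ((T ^^ (n * m)) x)" by (simp add: funpow_add)
  then show ?case using Suc assms by simp
qed simp

lemma forward_orbit_finite:
  assumes "(T ^^ n) x = x" "n \<ge> 1"
  shows "(\<lambda>i. (T ^^ i) x) ` {0..n} = range (\<lambda>i. (T ^^ i) x)"
    and "(\<lambda>i. (T ^^ i) x) ` {..<n} = range (\<lambda>i. (T ^^ i) x)"
proof -
  have "(T ^^ i) x = (T ^^ (i mod n)) x" "i mod n < n" for i
    using assms by (simp_all add: funpow_mod_eq)
  then have "range (\<lambda>i. (T ^^ i) x) \<subseteq> (\<lambda>i. (T ^^ i) x) ` {..<n}" by blast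
  moreover have "(\<lambda>i. (T ^^ i) x) ` {..<n} \<subseteq> (\<lambda>i. (T ^^ i) x) ` {0..n}" by (intro image_mono) auto
  ultimately show "(\<lambda>i. (T ^^ i) x) ` {0..n} = range (\<lambda>i. (T ^^ i) x)"
    "(\<lambda>i. (T ^^ i) x) ` {..<n} = range (\<lambda>i. (T ^^ i) x)" by blast+
qed

text \<open>A periodic orbit can be started at any of its points: multiples of the period undo the steps
  from \<open>x\<close> to \<open>y\<close>.\<close>

lemma forward_orbit_eq:
  assumes "(T ^^ n) x = x" "n \<ge> 1" "y \<in> range (\<lambda>i. (T ^^ i) x)"
  shows "range (\<lambda>i. (T ^^ i) y) = range (\<lambda>i. (T ^^ i) x)"
proof -
  obtain j where y: "y = (T ^^ j) x" using assms(3) by blast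
  have "(T ^^ i) y = (T ^^ (i + j)) x" for i by (simp add: y funpow_add)
  moreover have "(T ^^ i) x = (T ^^ (i + (n * j - j))) y" for i
  proof -
    have "j \<le> n * j" using assms(2) by (cases n) auto
    then have "(i + (n * j - j)) + j = i + n * j" by linarith
    then have "(T ^^ (i + (n * j - j))) y = (T ^^ (i + n * j)) x"
      unfolding y by (metis comp_apply funpow_add)
    then show ?thesis by (simp add: funpow_add funpow_fixed_mult[OF assms(1)])
  qed
  ultimately show ?thesis
    by (intro equalityI image_subsetI) (metis rangeI)+
qed

lemma card_closed_orbit: "C \<in> closed_orbits X T d \<Longrightarrow> card C = d"
  unfolding closed_orbits_def mem_Collect_eq by (elim bexE conjE)

lemma closed_orbit_iff:
  assumes "n \<ge> 1"
  shows "C \<in> closed_orbits X T n \<longleftrightarrow>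
    (\<exists>x\<in>X. C = range (\<lambda>i. (T ^^ i) x) \<and> (T ^^ n) x = x \<and> card C = n)"
  unfolding closed_orbits_def mem_Collect_eq
  by (rule bex_cong[OF refl]) (metis forward_orbit_finite(1)[OF _ assms])

lemma funpow_in_space: "T \<in> X \<rightarrow> X \<Longrightarrow> x \<in> X \<Longrightarrow> (T ^^ i) x \<in> X"
  by (induction i) auto

text \<open>The length \<open>d\<close> of the orbit is the least positive period; minimality makes the first \<open>d\<close>
  iterates distinct, and it makes \<open>n mod d\<close> vanish.\<close>

lemma fixed_point_orbit:
  assumes "x \<in> fixed_points X T n" "n \<ge> 1"
  obtains d where "d dvd n" "range (\<lambda>i. (T ^^ i) x) \<in> closed_orbits X T d"
proof
  define d where "d = (LEAST d. d \<ge> 1 \<and> (T ^^ d) x = x)"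
  have d: "d \<ge> 1" "(T ^^ d) x = x"
    using assms LeastI[of "\<lambda>d. d \<ge> 1 \<and> (T ^^ d) x = x" n]
    unfolding d_def fixed_points_def by blast+
  have least: "d \<le> e" if "e \<ge> 1" "(T ^^ e) x = x" for e
    unfolding d_def using that by (intro Least_le) auto
  have "(T ^^ (n mod d)) x = x"
    using assms d by (simp add: funpow_mod_eq fixed_points_def)
  with least[of "n mod d"] d(1) show "d dvd n"
    by (metis One_nat_def dvd_eq_mod_eq_0 leD less_eq_Suc_le mod_less_divisor neq0_conv)
  have inj: "inj_on (\<lambda>i. (T ^^ i) x) {..<d}"
  proof (rule linorder_inj_onI')
    fix i j assume ij: "i \<in> {..<d}" "j \<in> {..<d}" "i < j"
    show "(T ^^ i) x \<noteq> (T ^^ j) x"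
    proof
      assume "(T ^^ i) x = (T ^^ j) x"
      \<comment> \<open>A repetition \<open>i < j\<close> would give the positive period \<open>d - (j - i) < d\<close>.\<close>
      then have "(T ^^ (d - j + i)) x = (T ^^ (d - j + j)) x" by (simp only: funpow_add comp_apply)
      then have "(T ^^ (d - j + i)) x = x" using ij d by simp
      then show False using least[of "d - j + i"] ij by fastforce
    qed
  qed
  have "card (range (\<lambda>i. (T ^^ i) x)) = d"
    using card_image[OF inj] forward_orbit_finite(2)[OF d(2,1)] by simp
  then show "range (\<lambda>i. (T ^^ i) x) \<in> closed_orbits X T d"
    unfolding closed_orbit_iff[OF d(1)] using d(2) assms(1)
    by (intro bexI[of _ x] conjI) (simp_all add: fixed_points_def)
qed

lemma fixed_points_eq_Union:
  assumes T: "T \<in> X \<rightarrow> X" and n: "n \<ge> 1"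
  shows "fixed_points X T n = (\<Union>d\<in>{d. d dvd n}. \<Union>(closed_orbits X T d))"
proof (intro equalityI subsetI)
  fix x assume x: "x \<in> fixed_points X T n"
  from fixed_point_orbit[OF this n] obtain d
    where "d dvd n" "range (\<lambda>i. (T ^^ i) x) \<in> closed_orbits X T d" .
  moreover have "x \<in> range (\<lambda>i. (T ^^ i) x)" by (rule range_eqI[of _ _ 0]) simp
  ultimately show "x \<in> (\<Union>d\<in>{d. d dvd n}. \<Union>(closed_orbits X T d))" by blast
next
  fix x assume "x \<in> (\<Union>d\<in>{d. d dvd n}. \<Union>(closed_orbits X T d))"
  then obtain d C where d: "d dvd n" and C: "C \<in> closed_orbits X T d" "x \<in> C" by blast
  from d n have d1: "d \<ge> 1" by (cases d) auto
  from C obtain z where z: "z \<in> X" "C = range (\<lambda>i. (T ^^ i) z)" "(T ^^ d) z = z"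
    unfolding closed_orbit_iff[OF d1] by blast
  then obtain i where x: "x = (T ^^ i) z" using C by blast
  have "(T ^^ n) x = (T ^^ (i + n)) z" unfolding x by (metis add.commute comp_apply funpow_add)
  also have "\<dots> = x" using d z(3) by (auto simp: x funpow_add funpow_fixed_mult)
  finally show "x \<in> fixed_points X T n"
    using funpow_in_space[OF T z(1)] by (simp add: fixed_points_def x)
qed

lemma closed_orbits_eq_if_meet:
  assumes "C \<in> closed_orbits X T d" "C' \<in> closed_orbits X T e" "d \<ge> 1" "e \<ge> 1" "C \<inter> C' \<noteq> {}"
  shows "C = C' \<and> d = e"
proof -
  obtain x where x: "(T ^^ d) x = x" "C = range (\<lambda>i. (T ^^ i) x)" "card C = d"
    using assms(1) unfolding closed_orbit_iff[OF assms(3)] by metis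
  obtain y where y: "(T ^^ e) y = y" "C' = range (\<lambda>i. (T ^^ i) y)" "card C' = e"
    using assms(2) unfolding closed_orbit_iff[OF assms(4)] by metis
  obtain z where "z \<in> C" "z \<in> C'" using assms(5) by blast
  then have "C = C'"
    using forward_orbit_eq[OF x(1) assms(3), of z] forward_orbit_eq[OF y(1) assms(4), of z] x(2) y(2)
    by simp
  then show ?thesis using x(3) y(3) by simp
qed

text \<open>Orbits are disjoint and have \<open>d\<close> points each. If there are infinitely many, both cardinalities are
  \<open>0\<close> by convention.\<close>

lemma card_Union_closed_orbits:
  assumes "d \<ge> 1" shows "card (\<Union>(closed_orbits X T d)) = d * orbit_count X T d"
proof -
  note card = card_closed_orbit[of _ X T d]
  then have "finite C" if "C \<in> closed_orbits X T d" for C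
    using card[OF that] assms by (intro card_ge_0_finite) simp
  moreover have "pairwise disjnt (closed_orbits X T d)"
    using closed_orbits_eq_if_meet[of _ X T d _ d] assms by (auto simp: pairwise_def disjnt_def)
  ultimately have "card (\<Union>(closed_orbits X T d)) = sum card (closed_orbits X T d)"
    by (intro card_Union_disjoint)
  then show ?thesis by (simp add: card orbit_count_def)
qed

lemma card_fixed_points:
  assumes T: "T \<in> X \<rightarrow> X" and n: "n \<ge> 1" and fin: "finite (fixed_points X T n)"
  shows "card (fixed_points X T n) = (\<Sum>d | d dvd n. d * orbit_count X T d)"
proof -
  have d: "d \<ge> 1" if "d dvd n" for d using that n by (cases d) auto
  have "card (fixed_points X T n) = (\<Sum>d\<in>{d. d dvd n}. card (\<Union>(closed_orbits X T d)))"
    unfolding fixed_points_eq_Union[OF T n]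
  proof (rule card_UN_disjoint)
    show "finite {d. d dvd n}" using n by (intro finite_divisors_nat) simp
    show "\<forall>d\<in>{d. d dvd n}. finite (\<Union>(closed_orbits X T d))"
      using fin unfolding fixed_points_eq_Union[OF T n]
      by (auto intro: finite_subset[rotated])
    show "\<forall>d\<in>{d. d dvd n}. \<forall>e\<in>{d. d dvd n}. d \<noteq> e \<longrightarrow>
      \<Union>(closed_orbits X T d) \<inter> \<Union>(closed_orbits X T e) = {}"
    proof (intro ballI impI)
      fix d e assume "d \<in> {d. d dvd n}" "e \<in> {d. d dvd n}" "d \<noteq> e"
      then have "C \<inter> C' = {}" if "C \<in> closed_orbits X T d" "C' \<in> closed_orbits X T e" for C C'
        using closed_orbits_eq_if_meet[OF that] d by blast
      then show "\<Union>(closed_orbits X T d) \<inter> \<Union>(closed_orbits X T e) = {}" by blast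
    qed
  qed
  then show ?thesis using d card_Union_closed_orbits[of _ X T] by simp
qed

lemma finite_fixed_points:
  assumes T: "T \<in> X \<rightarrow> X" and n: "n \<ge> 1" and fin: "\<And>d. d \<ge> 1 \<Longrightarrow> finite (closed_orbits X T d)"
  shows "finite (fixed_points X T n)"
  unfolding fixed_points_eq_Union[OF T n]
proof (intro finite_UN_I finite_Union)
  show "finite {d. d dvd n}" using n by (intro finite_divisors_nat) simp
  fix d assume "d \<in> {d. d dvd n}"
  then have d: "d \<ge> 1" using n by (cases d) auto
  then show "finite (closed_orbits X T d)" by (rule fin)
  fix C assume "C \<in> closed_orbits X T d"
  then have "card C = d" by (rule card_closed_orbit)
  then show "finite C" using d by (intro card_ge_0_finite) simp
qed

lemma sum_divisors_prime_power:
  fixes p :: nat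
  assumes "prime p"
  shows "(\<Sum>d | d dvd p ^ k. f d) = (\<Sum>j\<le>k. f (p ^ j))"
proof -
  have "{d. d dvd p ^ k} = (\<lambda>j. p ^ j) ` {..k}"
    using assms by (auto simp: divides_primepow_nat)
  moreover have "inj_on (\<lambda>j. p ^ j) {..k}"
    using assms prime_gt_1_nat by (auto simp: inj_on_def)
  ultimately show ?thesis by (simp add: sum.reindex)
qed

lemma card_listset:
  "card (listset As) = prod_list (map card As) \<and> ((\<forall>A\<in>set As. finite A) \<longrightarrow> finite (listset As))"
proof (induction As)
  case (Cons A As)
  have "listset (A # As) = (\<lambda>(a, as). a # as) ` (A \<times> listset As)"
    by (auto simp: set_Cons_def)
  moreover have "inj_on (\<lambda>(a, as). a # as) (A \<times> listset As)" by (auto simp: inj_on_def)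
  ultimately show ?case using Cons by (simp add: card_image card_cartesian_product)
qed simp

lemma product_space_Cons:
  "x # xs \<in> product_space X (r # lam) \<longleftrightarrow> x \<in> X r \<and> xs \<in> product_space X lam"
  by (auto simp: product_space_def set_Cons_def)

lemma product_map_Cons: "product_map T (r # lam) (x # xs) = T r x # product_map T lam xs"
  by (simp add: product_map_def)

lemma product_space_cases:
  assumes "xs \<in> product_space X (r # lam)"
  obtains x xs' where "xs = x # xs'" "x \<in> X r" "xs' \<in> product_space X lam"
  using assms by (auto simp: product_space_def set_Cons_def)

lemma product_map_in_space:
  assumes "\<And>r. r \<in> set lam \<Longrightarrow> T r \<in> X r \<rightarrow> X r"
  shows "product_map T lam \<in> product_space X lam \<rightarrow> product_space X lam"
  using assms
proof (induction lam)
  case (Cons r lam)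
  show ?case
  proof
    fix xs assume "xs \<in> product_space X (r # lam)"
    then obtain x xs' where "xs = x # xs'" "x \<in> X r" "xs' \<in> product_space X lam"
      by (rule product_space_cases)
    then show "product_map T (r # lam) xs \<in> product_space X (r # lam)"
      using Cons by (auto simp: product_map_Cons product_space_Cons)
  qed
qed (simp add: product_space_def product_map_def)

lemma fixed_points_product:
  "fixed_points (product_space X lam) (product_map T lam) n =
    listset (map (\<lambda>r. fixed_points (X r) (T r) n) lam)"
proof (induction lam)
  case Nil
  have "(product_map T [] ^^ n) [] = []" by (induction n) (simp_all add: product_map_def)
  then show ?case by (auto simp: fixed_points_def product_space_def)
next
  case (Cons r lam)
  have iter: "(product_map T (r # lam) ^^ n) (x # xs) = (T r ^^ n) x # (product_map T lam ^^ n) xs" for x xs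
    by (induction n) (simp_all add: product_map_Cons)
  have "xs \<in> fixed_points (product_space X (r # lam)) (product_map T (r # lam)) n \<longleftrightarrow>
      (\<exists>x xs'. xs = x # xs' \<and> x \<in> fixed_points (X r) (T r) n \<and>
         xs' \<in> fixed_points (product_space X lam) (product_map T lam) n)" for xs
    by (auto simp: fixed_points_def iter product_space_Cons elim!: product_space_cases)
  then show ?case unfolding Cons by (auto simp: set_Cons_def)
qed

section \<open>Subgroups of given index\<close>

definition subgroups_of_index :: "('a, 'b) monoid_scheme \<Rightarrow> nat \<Rightarrow> 'a set set" where
  "subgroups_of_index G n = {H. subgroup H G \<and> card (rcosets\<^bsub>G\<^esub> H) = n}"

text \<open>Only the equivalence relation induced by a map matters for the size of its image. This lets an index
  be computed from any map whose fibres are the cosets, without constructing a bijection by hand.\<close>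

lemma card_image_same_kernel:
  assumes "\<And>x y. x \<in> A \<Longrightarrow> y \<in> A \<Longrightarrow> f x = f y \<longleftrightarrow> g x = g y"
  shows "card (f ` A) = card (g ` A)"
proof -
  define h where "h b = g (SOME x. x \<in> A \<and> f x = b)" for b
  have h: "h (f x) = g x" if "x \<in> A" for x
  proof -
    have "\<exists>z. z \<in> A \<and> f z = f x" using that by blast
    from someI_ex[OF this] show ?thesis unfolding h_def using assms that by blast
  qed
  have "bij_betw h (f ` A) (g ` A)"
    unfolding bij_betw_def inj_on_def image_image using h assms by auto
  then show ?thesis by (rule bij_betw_same_card)
qed

lemma (in group) r_coset_eq_iff:
  assumes "subgroup H G" "x \<in> carrier G" "y \<in> carrier G"
  shows "H #> x = H #> y \<longleftrightarrow> x \<otimes> inv y \<in> H"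
proof
  assume "H #> x = H #> y"
  then show "x \<otimes> inv y \<in> H"
    using subgroup.rcos_module[OF assms(1) is_group assms(3,2)] rcos_self[OF assms(2,1)] by simp
next
  assume "x \<otimes> inv y \<in> H"
  then have "x \<in> H #> y"
    using subgroup.rcos_module[OF assms(1) is_group assms(3,2)] by simp
  then show "H #> x = H #> y" using repr_independence assms by metis
qed

lemma (in group) card_rcosets_eq_card_image:
  assumes "subgroup H G"
    and "\<And>x y. x \<in> carrier G \<Longrightarrow> y \<in> carrier G \<Longrightarrow> f x = f y \<longleftrightarrow> x \<otimes> inv y \<in> H"
  shows "card (rcosets H) = card (f ` carrier G)"
proof -
  have "rcosets H = (\<lambda>x. H #> x) ` carrier G" by (auto simp: RCOSETS_def)
  also have "card \<dots> = card (f ` carrier G)"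
    using assms r_coset_eq_iff by (intro card_image_same_kernel) simp
  finally show ?thesis .
qed

lemma card_rcosets_iso:
  assumes "group G" "group F" "\<phi> \<in> iso G F" "subgroup H G"
  shows "card (rcosets\<^bsub>F\<^esub> (\<phi> ` H)) = card (rcosets\<^bsub>G\<^esub> H)"
proof -
  interpret G: group G by fact
  interpret F: group F by fact
  interpret \<phi>: group_hom G F \<phi>
    using assms by (simp add: group_hom_def group_hom_axioms_def iso_imp_homomorphism)
  have bij: "bij_betw \<phi> (carrier G) (carrier F)" using assms(3) by (simp add: iso_def)
  have sub: "subgroup (\<phi> ` H) F" using subgroup.iso_subgroup assms by metis
  have "card (rcosets\<^bsub>G\<^esub> H) = card ((\<lambda>x. \<phi> ` H #>\<^bsub>F\<^esub> \<phi> x) ` carrier G)"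
  proof (rule G.card_rcosets_eq_card_image[OF assms(4)])
    fix x y assume xy: "x \<in> carrier G" "y \<in> carrier G"
    have "\<phi> ` H #>\<^bsub>F\<^esub> \<phi> x = \<phi> ` H #>\<^bsub>F\<^esub> \<phi> y \<longleftrightarrow> \<phi> (x \<otimes>\<^bsub>G\<^esub> inv\<^bsub>G\<^esub> y) \<in> \<phi> ` H"
      using xy by (simp add: F.r_coset_eq_iff[OF sub])
    also have "\<dots> \<longleftrightarrow> x \<otimes>\<^bsub>G\<^esub> inv\<^bsub>G\<^esub> y \<in> H"
      using bij xy subgroup.subset[OF assms(4)] by (intro inj_on_image_mem_iff[of \<phi> "carrier G"]) (auto simp: bij_betw_def)
    finally show "\<phi> ` H #>\<^bsub>F\<^esub> \<phi> x = \<phi> ` H #>\<^bsub>F\<^esub> \<phi> y \<longleftrightarrow> x \<otimes>\<^bsub>G\<^esub> inv\<^bsub>G\<^esub> y \<in> H" .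
  qed
  also have "(\<lambda>x. \<phi> ` H #>\<^bsub>F\<^esub> \<phi> x) ` carrier G = (\<lambda>x. \<phi> ` H #>\<^bsub>F\<^esub> x) ` (\<phi> ` carrier G)"
    by (simp add: image_image)
  also have "\<dots> = rcosets\<^bsub>F\<^esub> (\<phi> ` H)" using bij by (auto simp: RCOSETS_def bij_betw_def)
  finally show ?thesis by simp
qed

lemma subgroups_of_index_iso:
  assumes "group G" "group F" "\<phi> \<in> iso G F"
  shows "bij_betw (\<lambda>H. \<phi> ` H) (subgroups_of_index G n) (subgroups_of_index F n)"
proof (rule bij_betw_byWitness[where f' = "\<lambda>H. inv_into (carrier G) \<phi> ` H"])
  have \<psi>: "inv_into (carrier G) \<phi> \<in> iso F G"
    using assms by (simp add: group.iso_set_sym)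
  have bij: "bij_betw \<phi> (carrier G) (carrier F)" using assms(3) by (simp add: iso_def)
  show "\<forall>H\<in>subgroups_of_index G n. inv_into (carrier G) \<phi> ` \<phi> ` H = H"
    using bij by (auto simp: subgroups_of_index_def bij_betw_def dest!: subgroup.subset
        intro!: inv_into_image_cancel)
  have "\<phi> ` inv_into (carrier G) \<phi> ` H = H" if "subgroup H F" for H
    using bij subgroup.subset[OF that] by (intro image_inv_into_cancel) (auto simp: bij_betw_def)
  then show "\<forall>H\<in>subgroups_of_index F n. \<phi> ` inv_into (carrier G) \<phi> ` H = H"
    by (simp add: subgroups_of_index_def)
  show "(\<lambda>H. \<phi> ` H) ` subgroups_of_index G n \<subseteq> subgroups_of_index F n"
    using assms card_rcosets_iso[OF assms] subgroup.iso_subgroup[OF _ assms]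
    by (auto simp: subgroups_of_index_def)
  show "(\<lambda>H. inv_into (carrier G) \<phi> ` H) ` subgroups_of_index F n \<subseteq> subgroups_of_index G n"
    using card_rcosets_iso[OF assms(2,1) \<psi>] subgroup.iso_subgroup[OF _ assms(2,1) \<psi>]
    by (auto simp: subgroups_of_index_def)
qed

section \<open>Subgroups of a product with the integers\<close>

text \<open>The subgroup of \<open>G \<times> Z\<close> generated by \<open>K \<times> {0}\<close> and the element \<open>(v, d)\<close>, for commutative \<open>G\<close>, described
  by its slices: the slice over \<open>m * d\<close> is the coset of \<open>K\<close> through the \<open>m\<close>-th power of \<open>v\<close>, all
  other slices are empty.\<close>

definition (in group) int_extension :: "nat \<Rightarrow> 'a set \<Rightarrow> 'a \<Rightarrow> ('a \<times> int) set" where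
  "int_extension d K v = {(g, z). g \<in> carrier G \<and> int d dvd z \<and> g \<otimes> inv (v [^] (z div int d)) \<in> K}"

context comm_group begin

lemma group_prod: "group (G \<times>\<times> integer_group)"
  by (intro DirProd_group is_group group_integer_group)

lemma inv_prod: "g \<in> carrier G \<Longrightarrow> inv\<^bsub>G \<times>\<times> integer_group\<^esub> (g, z) = (inv g, - z)"
  by (simp add: inv_DirProd[OF is_group group_integer_group])

lemma subgroup_int_extension:
  assumes K: "subgroup K G" and v: "v \<in> carrier G" and d: "d \<ge> 1"
  shows "subgroup (int_extension d K v) (G \<times>\<times> integer_group)"
proof -
  interpret P: group "G \<times>\<times> integer_group" by (rule group_prod)
  show ?thesis
  proof (rule P.subgroupI)
    show "int_extension d K v \<subseteq> carrier (G \<times>\<times> integer_group)" by (auto simp: int_extension_def)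
    have "(\<one>, 0) \<in> int_extension d K v" using subgroup.one_closed[OF K] by (simp add: int_extension_def)
    then show "int_extension d K v \<noteq> {}" by blast
    fix a assume "a \<in> int_extension d K v"
    then obtain g m where a: "a = (g, int d * m)" "g \<in> carrier G" "g \<otimes> inv (v [^] m) \<in> K"
      using d by (auto simp: int_extension_def elim!: dvdE)
    have "inv (g \<otimes> inv (v [^] m)) \<in> K" using a K by (simp add: subgroup.m_inv_closed)
    then have "inv g \<otimes> inv (v [^] (- m)) \<in> K" using a v by (simp add: inv_mult int_pow_inv int_pow_neg)
    moreover have "- (int d * m) div int d = - m" using d by (simp flip: mult_minus_right)
    ultimately show "inv\<^bsub>G \<times>\<times> integer_group\<^esub> a \<in> int_extension d K v"
      using a by (simp add: inv_prod int_extension_def)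
    fix b assume "b \<in> int_extension d K v"
    then obtain h n where b: "b = (h, int d * n)" "h \<in> carrier G" "h \<otimes> inv (v [^] n) \<in> K"
      using d by (auto simp: int_extension_def elim!: dvdE)
    have "(g \<otimes> inv (v [^] m)) \<otimes> (h \<otimes> inv (v [^] n)) \<in> K"
      using a b K by (simp add: subgroup.m_closed)
    then have "(g \<otimes> h) \<otimes> inv (v [^] (m + n)) \<in> K"
      using a b v by (simp add: int_pow_mult inv_mult m_ac)
    moreover have "(int d * m + int d * n) div int d = m + n" using d by (simp flip: distrib_left)
    ultimately show "a \<otimes>\<^bsub>G \<times>\<times> integer_group\<^esub> b \<in> int_extension d K v"
      using a b by (simp add: int_extension_def)
  qed
qed

text \<open>Subtracting a multiple of \<open>(v, d)\<close> moves any pair into the range \<open>0 \<le> z < d\<close>; what remains are \<open>d\<close> copies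
  of the cosets of \<open>K\<close>. The map \<open>f\<close> in the proof performs this reduction.\<close>

lemma card_rcosets_int_extension:
  assumes K: "subgroup K G" and v: "v \<in> carrier G" and d: "d \<ge> 1"
  shows "card (rcosets\<^bsub>G \<times>\<times> integer_group\<^esub> (int_extension d K v)) = d * card (rcosets K)"
proof -
  interpret P: group "G \<times>\<times> integer_group" by (rule group_prod)
  define f where "f = (\<lambda>(g, z). (K #> (g \<otimes> inv (v [^] (z div int d))), z mod int d))"
  have "card (rcosets\<^bsub>G \<times>\<times> integer_group\<^esub> (int_extension d K v)) = card (f ` carrier (G \<times>\<times> integer_group))"
  proof (rule P.card_rcosets_eq_card_image[OF subgroup_int_extension[OF assms]])
    fix a b assume "a \<in> carrier (G \<times>\<times> integer_group)" "b \<in> carrier (G \<times>\<times> integer_group)"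
    then obtain g z h w where a: "a = (g, z)" "g \<in> carrier G" and b: "b = (h, w)" "h \<in> carrier G"
      by auto
    have iff: "z mod int d = w mod int d \<longleftrightarrow> int d dvd z - w" by (rule mod_eq_dvd_iff)
    have "K #> (g \<otimes> inv (v [^] (z div int d))) = K #> (h \<otimes> inv (v [^] (w div int d))) \<longleftrightarrow>
        (g \<otimes> inv h) \<otimes> inv (v [^] ((z - w) div int d)) \<in> K" if dvd: "int d dvd z - w"
    proof -
      obtain m where m: "z - w = int d * m" using dvd by blast
      then have z: "z = w + int d * m" by simp
      have "z div int d = w div int d + m" "(z - w) div int d = m" using d by (simp_all add: z)
      moreover have "(g \<otimes> inv (v [^] (w div int d + m))) \<otimes> inv (h \<otimes> inv (v [^] (w div int d))) =
          (g \<otimes> inv h) \<otimes> inv (v [^] m)"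
      proof -
        have "(g \<otimes> inv (v [^] (w div int d + m))) \<otimes> inv (h \<otimes> inv (v [^] (w div int d))) =
            (g \<otimes> inv h) \<otimes> inv (v [^] m) \<otimes> (inv (v [^] (w div int d)) \<otimes> v [^] (w div int d))"
          using a b v by (simp add: int_pow_mult inv_mult m_ac del: l_inv r_inv)
        then show ?thesis using a b v by simp
      qed
      ultimately show ?thesis
        using a b v by (subst r_coset_eq_iff[OF K]) auto
    qed
    then show "f a = f b \<longleftrightarrow> a \<otimes>\<^bsub>G \<times>\<times> integer_group\<^esub> inv\<^bsub>G \<times>\<times> integer_group\<^esub> b \<in> int_extension d K v"
      using a b by (auto simp: f_def inv_prod int_extension_def iff)
  qed
  also have "f ` carrier (G \<times>\<times> integer_group) = (rcosets K) \<times> {0..<int d}"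
  proof (intro equalityI subsetI)
    fix c assume "c \<in> f ` carrier (G \<times>\<times> integer_group)"
    then obtain g z where "g \<in> carrier G" "c = (K #> (g \<otimes> inv (v [^] (z div int d))), z mod int d)"
      by (auto simp: f_def)
    moreover from this have "K #> (g \<otimes> inv (v [^] (z div int d))) \<in> rcosets K"
      using v subgroup.subset[OF K] by (intro rcosetsI) auto
    ultimately show "c \<in> (rcosets K) \<times> {0..<int d}" using d by simp
  next
    fix c assume "c \<in> (rcosets K) \<times> {0..<int d}"
    then obtain g z where c: "g \<in> carrier G" "c = (K #> g, z)" "0 \<le> z" "z < int d"
      by (auto simp: RCOSETS_def)
    then have "c = f (g, z)" by (simp add: f_def)
    then show "c \<in> f ` carrier (G \<times>\<times> integer_group)" using c(1) by (intro image_eqI) auto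
  qed
  finally show ?thesis by (simp add: card_cartesian_product mult.commute)
qed

text \<open>The data can be read off: \<open>d\<close> is the least positive second coordinate, \<open>K\<close> the slice over \<open>0\<close>, and the
  coset of \<open>v\<close> the slice over \<open>d\<close>.\<close>

lemma int_extension_eqD:
  assumes "subgroup K G" "v \<in> carrier G" "d \<ge> 1" "subgroup K' G" "v' \<in> carrier G" "d' \<ge> 1"
    and eq: "int_extension d K v = int_extension d' K' v'"
  shows "d = d'" "K = K'" "K #> v = K' #> v'"
proof -
  have top: "(v, int d) \<in> int_extension d K v" if "subgroup K G" "v \<in> carrier G" "d \<ge> 1" for d K v
    using that by (simp add: int_extension_def subgroup.one_closed)
  have "int d' dvd int d" using top[OF assms(1-3)] unfolding eq by (auto simp: int_extension_def)
  moreover have "int d dvd int d'" using top[OF assms(4-6)] unfolding eq[symmetric] by (auto simp: int_extension_def)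
  ultimately show d: "d = d'" by (simp add: dvd_antisym)
  have "K = {g. (g, 0) \<in> int_extension d K v}" if "subgroup K G" for d K v
    using subgroup.mem_carrier[OF that] by (auto simp: int_extension_def)
  with assms show K: "K = K'" by metis
  have "v \<otimes> inv v' \<in> K'"
    using top[OF assms(1-3)] assms unfolding eq d[symmetric] by (simp add: int_extension_def)
  with K assms show "K #> v = K' #> v'" by (simp add: r_coset_eq_iff)
qed

lemma int_extension_cong:
  assumes K: "subgroup K G" and v: "v \<in> carrier G" "w \<in> carrier G" and d: "d \<ge> 1" and eq: "K #> v = K #> w"
  shows "int_extension d K v = int_extension d K w"
proof -
  have vw: "v \<otimes> inv w \<in> K" using eq K v by (simp add: r_coset_eq_iff)
  have *: "g \<otimes> inv (w [^] m) \<in> K"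
    if "g \<otimes> inv (v [^] m) \<in> K" "v \<otimes> inv w \<in> K" "g \<in> carrier G" "v \<in> carrier G" "w \<in> carrier G"
    for g v w and m :: int
  proof -
    have "(v \<otimes> inv w) [^] m \<in> K"
      using subgroup_int_pow_closed[OF K that(2)] .
    then have "(g \<otimes> inv (v [^] m)) \<otimes> (v \<otimes> inv w) [^] m \<in> K"
      using that K by (simp add: subgroup.m_closed)
    also have "(v \<otimes> inv w) [^] m = v [^] m \<otimes> inv (w [^] m)"
      using that by (simp add: int_pow_distrib int_pow_inv)
    also have "(g \<otimes> inv (v [^] m)) \<otimes> (v [^] m \<otimes> inv (w [^] m)) = g \<otimes> inv (w [^] m)"
      using that by (metis int_pow_closed inv_closed l_inv l_one m_assoc m_closed)
    finally show ?thesis using that by simp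
  qed
  have wv: "w \<otimes> inv v \<in> K"
    using eq K v by (simp add: r_coset_eq_iff[symmetric])
  show ?thesis using *[OF _ vw _ v] *[OF _ wv _ v(2,1)] by (auto simp: int_extension_def)
qed

text \<open>Every subgroup of finite index arises in this way. Finite index forces the projection to \<open>Z\<close> to be non-zero,
  since otherwise the elements \<open>(1, z)\<close> lie in pairwise distinct cosets; \<open>d\<close> is the positive generator of
  the projection. The index is measured by \<open>card\<close>, for which infinite means \<open>0\<close>.\<close>

lemma subgroup_prod_int_cases:
  assumes H: "subgroup H (G \<times>\<times> integer_group)" and idx: "card (rcosets\<^bsub>G \<times>\<times> integer_group\<^esub> H) \<noteq> 0"
  obtains d K v where "d \<ge> 1" "subgroup K G" "v \<in> carrier G" "H = int_extension d K v"
proof -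
  interpret P: group "G \<times>\<times> integer_group" by (rule group_prod)
  have HG: "g \<in> carrier G" if "(g, z) \<in> H" for g z using subgroup.mem_carrier[OF H that] by simp
  have inv: "(inv g, - z) \<in> H" if "(g, z) \<in> H" for g z
    using subgroup.m_inv_closed[OF H that] HG[OF that] by (simp add: inv_prod)
  have mult: "(g \<otimes> h, z + w) \<in> H" if "(g, z) \<in> H" "(h, w) \<in> H" for g z h w
    using subgroup.m_closed[OF H that] by simp
  have one: "(\<one>, 0) \<in> H" using subgroup.one_closed[OF H] by simp
  have pow: "(g [^] n, int n * z) \<in> H" if "(g, z) \<in> H" for g z and n :: nat
  proof (induction n)
    case (Suc n)
    from mult[OF this that] show ?case by (simp add: algebra_simps)
  qed (simp add: one)
  have ipow: "(g [^] n, n * z) \<in> H" if "(g, z) \<in> H" for g z and n :: int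
  proof (cases n rule: int_cases2)
    case (nonneg k) then show ?thesis using pow[OF that, of k] by (simp add: int_pow_int)
  next
    case (nonpos k) then show ?thesis
      using inv[OF pow[OF that, of k]] HG[OF that] by (simp add: int_pow_neg_int)
  qed
  have "\<exists>z g. z \<noteq> 0 \<and> (g, z) \<in> H"
  proof (rule ccontr)
    assume none: "\<not> ?thesis"
    have "inj (\<lambda>z. H #>\<^bsub>G \<times>\<times> integer_group\<^esub> (\<one>, z))"
    proof (rule injI)
      fix z w :: int assume "H #>\<^bsub>G \<times>\<times> integer_group\<^esub> (\<one>, z) = H #>\<^bsub>G \<times>\<times> integer_group\<^esub> (\<one>, w)"
      then have "(\<one>, z - w) \<in> H" by (simp add: P.r_coset_eq_iff[OF H] inv_prod)
      with none have "z - w = 0" by blast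
      then show "z = w" by simp
    qed
    then have "infinite (range (\<lambda>z. H #>\<^bsub>G \<times>\<times> integer_group\<^esub> (\<one>, z)))"
      by (simp add: finite_image_iff infinite_UNIV_int)
    moreover have "range (\<lambda>z. H #>\<^bsub>G \<times>\<times> integer_group\<^esub> (\<one>, z)) \<subseteq> rcosets\<^bsub>G \<times>\<times> integer_group\<^esub> H"
      by (auto simp: RCOSETS_def)
    ultimately have "infinite (rcosets\<^bsub>G \<times>\<times> integer_group\<^esub> H)" using finite_subset by blast
    then show False using idx by simp
  qed
  then obtain z g where zg: "z \<noteq> 0" "(g, z) \<in> H" by blast
  have "\<exists>n::nat. n \<ge> 1 \<and> (\<exists>g. (g, int n) \<in> H)"
  proof (cases "z > 0")
    case True then show ?thesis using zg by (intro exI[of _ "nat z"]) auto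
  next
    case False then show ?thesis using inv[OF zg(2)] zg(1) by (intro exI[of _ "nat (- z)"]) auto
  qed
  note ex = this
  define d where "d = (LEAST n::nat. n \<ge> 1 \<and> (\<exists>g. (g, int n) \<in> H))"
  have "d \<ge> 1 \<and> (\<exists>g. (g, int d) \<in> H)" unfolding d_def by (rule LeastI_ex[OF ex])
  then obtain v where d: "d \<ge> 1" and v: "(v, int d) \<in> H" by blast
  have least: "d \<le> n" if "n \<ge> 1" "(g, int n) \<in> H" for n g
    unfolding d_def using that by (intro Least_le) auto
  define K where "K = {g. (g, 0::int) \<in> H}"
  have vG: "v \<in> carrier G" using HG[OF v] .
  have K: "subgroup K G"
  proof (rule subgroupI)
    show "K \<subseteq> carrier G" using HG by (auto simp: K_def)
    show "K \<noteq> {}" using one by (auto simp: K_def)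
  qed (use inv mult in \<open>force simp: K_def\<close>)+
  have dvd: "int d dvd z" if "(g, z) \<in> H" for g z
  proof -
    have "(g \<otimes> v [^] (- (z div int d)), z + (- (z div int d)) * int d) \<in> H"
      by (intro mult that ipow v)
    moreover have "z + (- (z div int d)) * int d = z mod int d"
      by (simp add: minus_div_mult_eq_mod)
    moreover have "z mod int d = int (nat (z mod int d))" using d by simp
    ultimately have "(g \<otimes> v [^] (- (z div int d)), int (nat (z mod int d))) \<in> H" by simp
    with least[of "nat (z mod int d)"] d have "\<not> nat (z mod int d) \<ge> 1"
      by (metis le_nat_iff leD nat_less_iff of_nat_0_less_iff order.strict_trans2 pos_mod_bound pos_mod_sign zero_less_one less_le_not_le nat_int)
    moreover have "z mod int d \<ge> 0" using d by simp
    ultimately show ?thesis by (simp add: dvd_eq_mod_eq_0)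
  qed
  have mem: "(g, int d * m) \<in> H \<longleftrightarrow> g \<otimes> inv (v [^] m) \<in> K" if "g \<in> carrier G" for g m
  proof
    assume "(g, int d * m) \<in> H"
    from mult[OF this ipow[OF v, of "- m"]] show "g \<otimes> inv (v [^] m) \<in> K"
      using vG by (simp add: K_def int_pow_neg mult.commute)
  next
    assume "g \<otimes> inv (v [^] m) \<in> K"
    then have "(g \<otimes> inv (v [^] m) \<otimes> v [^] m, 0 + m * int d) \<in> H"
      unfolding K_def by (intro mult ipow v) simp
    then show "(g, int d * m) \<in> H" using that vG by (simp add: m_assoc mult.commute)
  qed
  have "H = int_extension d K v"
  proof (intro equalityI subsetI)
    fix a assume "a \<in> H"
    moreover obtain g z where a: "a = (g, z)" by (cases a)
    ultimately obtain m where "z = int d * m" using dvd by blast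
    with a \<open>a \<in> H\<close> show "a \<in> int_extension d K v" using HG mem[of g m] d by (auto simp: int_extension_def)
  next
    fix a assume "a \<in> int_extension d K v"
    then show "a \<in> H" using mem d by (auto simp: int_extension_def elim!: dvdE)
  qed
  with d K vG show thesis by (intro that)
qed

text \<open>The parametrisation of the subgroups of index \<open>n\<close> in \<open>G \<times> Z\<close>. Since \<open>int_extension\<close> depends on \<open>v\<close> only
  through its coset, an arbitrary representative \<open>rep C\<close> of the coset \<open>C\<close> is used.\<close>

lemma bij_betw_int_extension:
  assumes n: "n \<ge> 1"
  defines "rep \<equiv> \<lambda>C. SOME v. v \<in> C"
  shows "bij_betw (\<lambda>(d, K, C). int_extension d K (rep C))
    (SIGMA d:{d. d dvd n}. SIGMA K:subgroups_of_index G (n div d). rcosets K)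
    (subgroups_of_index (G \<times>\<times> integer_group) n)"
proof -
  have rep: "rep C \<in> carrier G" "K #> rep C = C" if K: "subgroup K G" and C: "C \<in> rcosets K" for K C
  proof -
    have "C \<noteq> {}" using subgroup.rcosets_non_empty[OF K C] .
    then have "rep C \<in> C" unfolding rep_def by (simp add: some_in_eq)
    moreover obtain a where a: "a \<in> carrier G" "C = K #> a" using C by (auto simp: RCOSETS_def)
    ultimately show "rep C \<in> carrier G" "K #> rep C = C"
      using repr_independence[OF _ a(1) K] r_coset_subset_G[OF subgroup.subset[OF K] a(1)]
      by auto
  qed
  have d1: "d \<ge> 1" if "d dvd n" for d using that n by (cases d) auto
  let ?f = "\<lambda>(d, K, C). int_extension d K (rep C)"
  let ?S = "SIGMA d:{d. d dvd n}. SIGMA K:subgroups_of_index G (n div d). rcosets K"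
  have "inj_on ?f ?S"
  proof (rule inj_onI)
    fix s t assume st: "s \<in> ?S" "t \<in> ?S" and f_eq: "?f s = ?f t"
    obtain d K C where s: "s = (d, K, C)" by (cases s)
    obtain d' K' C' where t: "t = (d', K', C')" by (cases t)
    have *: "d dvd n" "K \<in> subgroups_of_index G (n div d)" "C \<in> rcosets K"
      "d' dvd n" "K' \<in> subgroups_of_index G (n div d')" "C' \<in> rcosets K'"
      using st by (auto simp: s t)
    have eq: "int_extension d K (rep C) = int_extension d' K' (rep C')" using f_eq by (simp add: s t)
    have K: "subgroup K G" "subgroup K' G" using * by (auto simp: subgroups_of_index_def)
    note eqs = int_extension_eqD[OF K(1) rep(1)[OF K(1) *(3)] d1[OF *(1)] K(2) rep(1)[OF K(2) *(6)] d1[OF *(4)] eq]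
    then show "s = t" using rep(2)[OF K(1) *(3)] rep(2)[OF K(2) *(6)] by (simp add: s t)
  qed
  moreover have "?f ` ?S = subgroups_of_index (G \<times>\<times> integer_group) n"
  proof (intro equalityI subsetI)
    fix H assume "H \<in> ?f ` ?S"
    then obtain d K C where *: "d dvd n" "K \<in> subgroups_of_index G (n div d)" "C \<in> rcosets K"
      and H: "H = int_extension d K (rep C)" by auto
    then have K: "subgroup K G" "card (rcosets K) = n div d" by (auto simp: subgroups_of_index_def)
    show "H \<in> subgroups_of_index (G \<times>\<times> integer_group) n"
      using subgroup_int_extension[OF K(1) rep(1)[OF K(1) *(3)] d1[OF *(1)]]
        card_rcosets_int_extension[OF K(1) rep(1)[OF K(1) *(3)] d1[OF *(1)]] *(1)
      by (simp add: H subgroups_of_index_def K(2))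
  next
    fix H assume H: "H \<in> subgroups_of_index (G \<times>\<times> integer_group) n"
    then obtain d K v where *: "d \<ge> 1" "subgroup K G" "v \<in> carrier G" "H = int_extension d K v"
      using n subgroup_prod_int_cases[of H] by (auto simp: subgroups_of_index_def)
    have n_eq: "d * card (rcosets K) = n"
      using H card_rcosets_int_extension[OF *(2,3,1)] by (simp add: subgroups_of_index_def *(4))
    have C: "K #> v \<in> rcosets K" using *(3) by (auto simp: RCOSETS_def)
    have "H = ?f (d, K, K #> v)"
      using int_extension_cong[OF *(2,3) rep(1)[OF *(2) C] *(1)] rep(2)[OF *(2) C] by (simp add: *(4))
    moreover have "(d, K, K #> v) \<in> ?S"
      using n_eq * C by (auto simp: subgroups_of_index_def)
    ultimately show "H \<in> ?f ` ?S" by blast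
  qed
  ultimately show ?thesis by (simp add: bij_betw_def)
qed

lemma subgroups_of_index_prod_int:
  assumes n: "n \<ge> 1" and fin: "\<And>m. m \<ge> 1 \<Longrightarrow> finite (subgroups_of_index G m)"
  shows "finite (subgroups_of_index (G \<times>\<times> integer_group) n)"
    and "card (subgroups_of_index (G \<times>\<times> integer_group) n) =
      (\<Sum>d | d dvd n. d * card (subgroups_of_index G d))"
proof -
  let ?S = "SIGMA d:{d. d dvd n}. SIGMA K:subgroups_of_index G (n div d). rcosets K"
  have divs: "finite {d. d dvd n}" using n by (intro finite_divisors_nat) simp
  have q: "n div d \<ge> 1" if "d dvd n" for d using that n by (auto elim!: dvdE simp: Suc_le_eq)
  have rc: "finite (rcosets K)" if "K \<in> subgroups_of_index G (n div d)" "d dvd n" for K d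
    using q[OF that(2)] that(1) by (intro card_ge_0_finite) (auto simp: subgroups_of_index_def)
  have inner: "finite (SIGMA K:subgroups_of_index G (n div d). rcosets K)"
    "card (SIGMA K:subgroups_of_index G (n div d). rcosets K) = (n div d) * card (subgroups_of_index G (n div d))"
    if "d dvd n" for d
  proof -
    show "finite (SIGMA K:subgroups_of_index G (n div d). rcosets K)"
      using fin[OF q[OF that]] rc[OF _ that] by (intro finite_SigmaI)
    have "card (SIGMA K:subgroups_of_index G (n div d). rcosets K) =
        (\<Sum>K\<in>subgroups_of_index G (n div d). card (rcosets K))"
      using fin[OF q[OF that]] rc[OF _ that] by (intro card_SigmaI) auto
    also have "\<dots> = (\<Sum>K\<in>subgroups_of_index G (n div d). n div d)"
      by (intro sum.cong refl) (auto simp: subgroups_of_index_def)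
    finally show "card (SIGMA K:subgroups_of_index G (n div d). rcosets K) =
        (n div d) * card (subgroups_of_index G (n div d))" by (simp add: mult.commute)
  qed
  have "finite ?S" by (rule finite_SigmaI[OF divs]) (use inner(1) in blast)
  then show "finite (subgroups_of_index (G \<times>\<times> integer_group) n)"
    using bij_betw_finite[OF bij_betw_int_extension[OF n]] by simp
  have "card (subgroups_of_index (G \<times>\<times> integer_group) n) = card ?S"
    using bij_betw_same_card[OF bij_betw_int_extension[OF n]] by simp
  also have "\<dots> = (\<Sum>d | d dvd n. card (SIGMA K:subgroups_of_index G (n div d). rcosets K))"
    by (rule card_SigmaI[OF divs]) (use inner(1) in blast)
  also have "\<dots> = (\<Sum>d | d dvd n. (n div d) * card (subgroups_of_index G (n div d)))"
    by (intro sum.cong refl inner(2)) simp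
  also have "\<dots> = (\<Sum>d | d dvd n. d * card (subgroups_of_index G d))"
    using n by (intro sum.reindex_bij_witness[of _ "\<lambda>d. n div d" "\<lambda>d. n div d"])
      (auto elim!: dvdE)
  finally show "card (subgroups_of_index (G \<times>\<times> integer_group) n) =
      (\<Sum>d | d dvd n. d * card (subgroups_of_index G d))" .
qed

end

section \<open>Subgroups of free abelian groups\<close>

lemma comm_group_Z_pow: "comm_group (Z_pow r)"
proof (rule group.group_comm_groupI)
  show "group (Z_pow r)" unfolding Z_pow_def by (rule product_group) simp
qed (auto simp: Z_pow_def add.commute)

text \<open>Elements of \<open>Z_pow r\<close> are functions that are \<open>undefined\<close> outside \<open>{..<r}\<close>, hence the restriction.\<close>

lemma Z_pow_Suc_iso:
  "(\<lambda>f. (restrict f {..<r}, f r)) \<in> iso (Z_pow (Suc r)) (Z_pow r \<times>\<times> integer_group)"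
proof -
  let ?\<phi> = "\<lambda>f::nat \<Rightarrow> int. (restrict f {..<r}, f r)"
  have "?\<phi> \<in> hom (Z_pow (Suc r)) (Z_pow r \<times>\<times> integer_group)"
    by (auto simp: hom_def Z_pow_def fun_eq_iff restrict_def)
  moreover have "bij_betw ?\<phi> (carrier (Z_pow (Suc r))) (carrier (Z_pow r \<times>\<times> integer_group))"
  proof (rule bij_betw_byWitness[where f' = "\<lambda>(g, z). g(r := z)"])
    show "\<forall>f\<in>carrier (Z_pow (Suc r)). (case ?\<phi> f of (g, z) \<Rightarrow> g(r := z)) = f"
      by (auto simp: Z_pow_def fun_eq_iff PiE_def extensional_def less_Suc_eq)
    show "\<forall>a\<in>carrier (Z_pow r \<times>\<times> integer_group). ?\<phi> (case a of (g, z) \<Rightarrow> g(r := z)) = a"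
      by (auto simp: Z_pow_def fun_eq_iff PiE_def extensional_def)
  qed (auto simp: Z_pow_def PiE_def extensional_def)
  ultimately show ?thesis by (simp add: iso_def)
qed

lemma subgroup_count_eq: "subgroup_count r n = card (subgroups_of_index (Z_pow r) n)"
  by (simp add: subgroup_count_def subgroups_of_index_def)

lemma subgroup_count_0: "subgroup_count 0 n = (if n = 1 then 1 else 0)"
proof -
  have C: "carrier (Z_pow 0) = {\<lambda>_. undefined}" by (simp add: Z_pow_def)
  interpret comm_group "Z_pow 0" by (rule comm_group_Z_pow)
  have "subgroup H (Z_pow 0) \<longleftrightarrow> H = carrier (Z_pow 0)" for H
    using subgroup.subset[of H "Z_pow 0"] subgroup_nonempty[of "Z_pow 0"] subgroup_self
    unfolding C by (metis subset_singletonD)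
  moreover have "card (rcosets\<^bsub>Z_pow 0\<^esub> (carrier (Z_pow 0))) = 1"
    by (simp add: RCOSETS_def C)
  ultimately have "{H. subgroup H (Z_pow 0) \<and> card (rcosets\<^bsub>Z_pow 0\<^esub> H) = n} =
      (if n = 1 then {carrier (Z_pow 0)} else {})" by auto
  then show ?thesis by (simp add: subgroup_count_def)
qed

lemma subgroups_of_index_Z_pow_Suc:
  "bij_betw (\<lambda>H. (\<lambda>f. (restrict f {..<r}, f r)) ` H) (subgroups_of_index (Z_pow (Suc r)) n)
    (subgroups_of_index (Z_pow r \<times>\<times> integer_group) n)"
  using comm_group_Z_pow
  by (intro subgroups_of_index_iso Z_pow_Suc_iso DirProd_group) (simp_all add: comm_group_def)

lemma finite_subgroups_of_index_Z_pow:
  "n \<ge> 1 \<Longrightarrow> finite (subgroups_of_index (Z_pow r) n)"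
proof (induction r arbitrary: n)
  case 0
  show ?case
    by (rule finite_subset[of _ "Pow (carrier (Z_pow 0))"])
       (auto simp: subgroups_of_index_def dest: subgroup.mem_carrier, simp add: Z_pow_def)
next
  case (Suc r)
  then show ?case
    using bij_betw_finite[OF subgroups_of_index_Z_pow_Suc[of r n]]
      comm_group.subgroups_of_index_prod_int(1)[OF comm_group_Z_pow[of r] Suc.prems] by blast
qed

lemma subgroup_count_Suc:
  assumes "n \<ge> 1"
  shows "subgroup_count (Suc r) n = (\<Sum>d | d dvd n. d * subgroup_count r d)"
  unfolding subgroup_count_eq bij_betw_same_card[OF subgroups_of_index_Z_pow_Suc[of r n]]
  by (rule comm_group.subgroups_of_index_prod_int(2)[OF comm_group_Z_pow assms])
     (rule finite_subgroups_of_index_Z_pow)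

section \<open>Specialisation of rational functions\<close>

text \<open>Unital ring homomorphisms between whole types. Evaluation of bivariate polynomials is obtained by
  iterating the step from coefficients to univariate polynomials in \<open>is_hom_poly_map_poly\<close>.\<close>

definition is_hom :: "('a::comm_ring_1 \<Rightarrow> 'b::comm_ring_1) \<Rightarrow> bool" where
  "is_hom h \<longleftrightarrow> h 1 = 1 \<and> (\<forall>a b. h (a + b) = h a + h b) \<and> (\<forall>a b. h (a * b) = h a * h b)"

lemma is_homD:
  assumes "is_hom h"
  shows "h 1 = 1" "h (a + b) = h a + h b" "h (a * b) = h a * h b" "h 0 = 0"
    "h (- a) = - h a" "h (a - b) = h a - h b" "h (sum f S) = (\<Sum>i\<in>S. h (f i))"
proof -
  show *: "h 1 = 1" and add: "\<And>a b. h (a + b) = h a + h b" and "h (a * b) = h a * h b"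
    using assms by (auto simp: is_hom_def)
  have "h (0 + 0) = h 0 + h 0" by (rule add)
  then show zero: "h 0 = 0" by simp
  have minus: "h (- a) = - h a" for a
    using add[of a "- a"] zero by (simp add: eq_neg_iff_add_eq_0 add.commute)
  show "h (- a) = - h a" by (rule minus)
  show "h (a - b) = h a - h b" using add[of a "- b"] minus[of b] by simp
  show "h (sum f S) = (\<Sum>i\<in>S. h (f i))"
    by (induction S rule: infinite_finite_induct) (simp_all add: zero add)
qed

lemma is_hom_poly_map_poly:
  fixes h :: "'a::comm_ring_1 \<Rightarrow> 'b::comm_ring_1"
  assumes "is_hom h"
  shows "is_hom (\<lambda>p. poly (map_poly h p) x)"
proof -
  note h = is_homD[OF assms]
  have "map_poly h (p + q) = map_poly h p + map_poly h q" for p q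
    by (intro poly_eqI) (simp add: coeff_map_poly h)
  moreover have "map_poly h (p * q) = map_poly h p * map_poly h q" for p q
    by (intro poly_eqI) (simp add: coeff_map_poly coeff_mult h)
  ultimately show ?thesis
    by (simp add: is_hom_def h map_poly_1)
qed

lemma is_hom_bipoly_eval:
  assumes "is_hom c" shows "is_hom (\<lambda>P. bipoly_eval c P x y)"
  unfolding bipoly_eval_def by (intro is_hom_poly_map_poly assms)

lemma is_hom_of_rat: "is_hom (of_rat :: rat \<Rightarrow> 'a::field_char_0)"
  by (simp add: is_hom_def of_rat_add of_rat_mult)

lemma is_hom_const_ratfun: "is_hom const_ratfun"
  by (simp add: is_hom_def const_ratfun_def flip: to_fract_add to_fract_mult)
     (simp add: one_pCons flip: to_fract_1)

text \<open>The pairs \<open>(R, v)\<close> with \<open>specialises c x y R v\<close> form the graph of the evaluation homomorphism on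
  the local ring of rational functions defined at \<open>(x, y)\<close>. The closure rules below allow values of explicit
  expressions to be computed without looking at lowest terms.\<close>

definition specialises :: "(rat \<Rightarrow> 'k::field) \<Rightarrow> 'k \<Rightarrow> 'k \<Rightarrow> ratfun \<Rightarrow> 'k \<Rightarrow> bool" where
  "specialises c x y R v \<longleftrightarrow> ratfun_defined c R x y \<and> ratfun_eval c R x y = v"

lemma specialises_fun: "specialises c x y R v \<Longrightarrow> specialises c x y R w \<Longrightarrow> v = w"
  by (simp add: specialises_def)

context
  fixes c :: "rat \<Rightarrow> 'k::field" and x y :: 'k
  assumes c: "is_hom c"
begin

lemma ev_hom: "is_hom (\<lambda>P. bipoly_eval c P x y)"
  by (rule is_hom_bipoly_eval[OF c])

text \<open>Any representation with a denominator that does not vanish at the point computes the value: by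
  coprimality the reduced denominator divides it.\<close>

lemma specialises_fractI:
  assumes R: "R = to_fract A / to_fract B" and B: "bipoly_eval c B x y \<noteq> 0"
  shows "specialises c x y R (bipoly_eval c A x y / bipoly_eval c B x y)"
proof -
  note h = is_homD[OF ev_hom]
  define a b where "a = fst (quot_of_fract R)" and "b = snd (quot_of_fract R)"
  have B0: "B \<noteq> 0" using B h(4) by auto
  have b0: "b \<noteq> 0" by (simp add: b_def)
  have "R = to_fract a / to_fract b"
    unfolding a_def b_def by (metis Fract_conv_to_fract Fract_quot_of_fract)
  then have eq: "A * b = a * B"
    using R B0 b0 by (simp add: frac_eq_eq flip: to_fract_mult)
  have "coprime a b" unfolding a_def b_def by (rule coprime_quot_of_fract)
  moreover have "b dvd a * B" using eq by (metis dvd_triv_right)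
  ultimately have "b dvd B" by (metis coprime_commute coprime_dvd_mult_right_iff)
  then obtain d where d: "B = b * d" by blast
  then have A: "A = a * d" using eq b0 by (simp add: mult.commute mult.left_commute)
  have nz: "bipoly_eval c b x y \<noteq> 0" "bipoly_eval c d x y \<noteq> 0"
    using B unfolding d h by auto
  then show ?thesis
    unfolding specialises_def ratfun_defined_def ratfun_eval_def a_def[symmetric] b_def[symmetric]
    by (simp add: A d h)
qed

lemma specialisesE:
  assumes "specialises c x y R v"
  obtains A B where "R = to_fract A / to_fract B" "bipoly_eval c B x y \<noteq> 0" "B \<noteq> 0"
    "v = bipoly_eval c A x y / bipoly_eval c B x y"
proof
  show "R = to_fract (fst (quot_of_fract R)) / to_fract (snd (quot_of_fract R))"
    by (metis Fract_conv_to_fract Fract_quot_of_fract)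
  show "snd (quot_of_fract R) \<noteq> 0" by simp
qed (use assms in \<open>auto simp: specialises_def ratfun_defined_def ratfun_eval_def\<close>)

lemma specialises_to_fract: "specialises c x y (to_fract A) (bipoly_eval c A x y)"
  using specialises_fractI[of "to_fract A" A 1] is_homD(1)[OF ev_hom] by simp

lemma specialises_add:
  assumes "specialises c x y R v" "specialises c x y S w"
  shows "specialises c x y (R + S) (v + w)"
proof -
  note h = is_homD[OF ev_hom]
  obtain A B where R: "R = to_fract A / to_fract B" "bipoly_eval c B x y \<noteq> 0" "B \<noteq> 0"
      "v = bipoly_eval c A x y / bipoly_eval c B x y" using assms(1) by (rule specialisesE)
  obtain A' B' where S: "S = to_fract A' / to_fract B'" "bipoly_eval c B' x y \<noteq> 0" "B' \<noteq> 0"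
      "w = bipoly_eval c A' x y / bipoly_eval c B' x y" using assms(2) by (rule specialisesE)
  have "R + S = to_fract (A * B' + A' * B) / to_fract (B * B')"
    using R S by (simp add: add_frac_eq)
  from specialises_fractI[OF this] R S show ?thesis
    by (simp add: h add_frac_eq)
qed

lemma specialises_mult:
  assumes "specialises c x y R v" "specialises c x y S w"
  shows "specialises c x y (R * S) (v * w)"
proof -
  note h = is_homD[OF ev_hom]
  obtain A B where R: "R = to_fract A / to_fract B" "bipoly_eval c B x y \<noteq> 0" "B \<noteq> 0"
      "v = bipoly_eval c A x y / bipoly_eval c B x y" using assms(1) by (rule specialisesE)
  obtain A' B' where S: "S = to_fract A' / to_fract B'" "bipoly_eval c B' x y \<noteq> 0" "B' \<noteq> 0"
      "w = bipoly_eval c A' x y / bipoly_eval c B' x y" using assms(2) by (rule specialisesE)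
  have "R * S = to_fract (A * A') / to_fract (B * B')"
    using R S by simp
  from specialises_fractI[OF this] R S show ?thesis
    by (simp add: h)
qed

lemma specialises_inverse:
  assumes "specialises c x y R v" "v \<noteq> 0"
  shows "specialises c x y (inverse R) (inverse v)"
proof -
  obtain A B where R: "R = to_fract A / to_fract B" "bipoly_eval c B x y \<noteq> 0" "B \<noteq> 0"
      "v = bipoly_eval c A x y / bipoly_eval c B x y" using assms(1) by (rule specialisesE)
  have "inverse R = to_fract B / to_fract A"
    using R by simp
  from specialises_fractI[OF this] R assms(2) show ?thesis by simp
qed

lemma specialises_divide:
  "specialises c x y R v \<Longrightarrow> specialises c x y S w \<Longrightarrow> w \<noteq> 0 \<Longrightarrow> specialises c x y (R / S) (v / w)"
  by (simp add: divide_inverse specialises_mult specialises_inverse)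

lemma specialises_of_int: "specialises c x y (of_int n) (of_int n)"
proof -
  note h = is_homD[OF ev_hom]
  have "bipoly_eval c (of_nat k) x y = of_nat k" for k
    by (induction k) (simp_all add: h)
  then have "bipoly_eval c (of_int n) x y = of_int n"
    by (cases n rule: int_cases2) (simp_all add: h)
  moreover have "(of_int n :: ratfun) = to_fract (of_int n)"
  proof -
    have "(of_nat k :: ratfun) = to_fract (of_nat k)" for k by (induction k) simp_all
    then show ?thesis by (cases n rule: int_cases2) simp_all
  qed
  ultimately show ?thesis using specialises_to_fract[of "of_int n"] by simp
qed

lemma specialises_0: "specialises c x y 0 0" and specialises_1: "specialises c x y 1 1"
  using specialises_of_int[of 0] specialises_of_int[of 1] by simp_all

lemma specialises_uminus: "specialises c x y R v \<Longrightarrow> specialises c x y (- R) (- v)"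
  using specialises_mult[OF specialises_of_int[of "- 1"]] by fastforce

lemma specialises_diff:
  "specialises c x y R v \<Longrightarrow> specialises c x y S w \<Longrightarrow> specialises c x y (R - S) (v - w)"
  using specialises_add[OF _ specialises_uminus] by fastforce

lemma specialises_sum:
  "(\<And>i. i \<in> I \<Longrightarrow> specialises c x y (f i) (g i)) \<Longrightarrow> specialises c x y (sum f I) (sum g I)"
  by (induction I rule: infinite_finite_induct) (auto intro: specialises_0 specialises_add)

lemma specialises_power: "specialises c x y R v \<Longrightarrow> specialises c x y (R ^ n) (v ^ n)"
  by (induction n) (auto intro: specialises_1 specialises_mult)

lemma specialises_powi:
  "specialises c x y R v \<Longrightarrow> v \<noteq> 0 \<Longrightarrow> specialises c x y (R powi n) (v powi n)"
  by (auto simp: power_int_def intro: specialises_power specialises_inverse)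

lemma specialises_X: "specialises c x y X_ratfun x"
  using specialises_to_fract[of "[:[:0, 1:]:]"] is_homD[OF c]
  by (simp add: X_ratfun_def bipoly_eval_def map_poly_pCons)

lemma specialises_Y: "specialises c x y Y_ratfun y"
  using specialises_to_fract[of "[:0, 1:]"] is_homD[OF c]
  by (simp add: Y_ratfun_def bipoly_eval_def map_poly_pCons)

lemma specialises_const: "specialises c x y (const_ratfun a) (c a)"
  using specialises_to_fract[of "[:[:a:]:]"] is_homD[OF c]
  by (simp add: const_ratfun_def bipoly_eval_def map_poly_pCons)

lemma specialises_poly:
  assumes "\<And>i. specialises c x y (coeff P i) (coeff Q i)" "specialises c x y R v"
  shows "specialises c x y (poly P R) (poly Q v)"
proof -
  define n where "n = max (degree P) (degree Q)"
  have "poly P R = (\<Sum>i\<le>n. coeff P i * R ^ i)"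
    by (subst poly_altdef, intro sum.mono_neutral_left) (auto simp: n_def coeff_eq_0)
  moreover have "poly Q v = (\<Sum>i\<le>n. coeff Q i * v ^ i)"
    by (subst poly_altdef, intro sum.mono_neutral_left) (auto simp: n_def coeff_eq_0)
  ultimately show ?thesis
    by (auto intro!: specialises_sum specialises_mult specialises_power assms)
qed

text \<open>Specialisation respects sums and products, so it can be pushed through a polynomial substitution.\<close>

lemma specialises_bipoly_eval:
  assumes "specialises c x y R v" "specialises c x y S w"
  shows "specialises c x y (bipoly_eval const_ratfun P R S) (bipoly_eval c P v w)"
proof -
  have [simp]: "c 0 = 0" "const_ratfun 0 = 0"
    by (rule is_homD[OF c] is_homD[OF is_hom_const_ratfun])+
  show ?thesis
    unfolding bipoly_eval_def
    by (intro specialises_poly assms) (simp add: coeff_map_poly, intro specialises_poly assms,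
      simp add: coeff_map_poly specialises_const)
qed

text \<open>Inverting the variables formally and evaluating at \<open>(x, y)\<close> amounts to evaluating at \<open>(1/x, 1/y)\<close>. The
  denominator of the formal substitution is non-zero because its specialisation is.\<close>

lemma specialises_ratfun_invert:
  assumes "specialises c (inverse x) (inverse y) R v" "x \<noteq> 0" "y \<noteq> 0"
  shows "specialises c x y (ratfun_invert R) v"
  using assms unfolding ratfun_invert_def ratfun_eval_def specialises_def[of c "inverse x"]
  by (auto simp: ratfun_defined_def intro!: specialises_divide specialises_bipoly_eval
      specialises_inverse specialises_X specialises_Y)

end

lemma bipoly_zeros_imp_0:
  fixes P :: "rat poly poly"
  assumes "infinite A" and "\<And>a. a \<in> A \<Longrightarrow> infinite {y::complex. bipoly_eval of_rat P (of_nat a) y = 0}"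
  shows "P = 0"
proof -
  have coeff: "poly (coeff P i) (of_nat a) = 0" if "a \<in> A" for a i
  proof -
    let ?Q = "map_poly (\<lambda>q. poly (map_poly of_rat q) (of_nat a :: complex)) P"
    have "?Q = 0"
      using assms(2)[OF that] poly_roots_finite[of ?Q] by (auto simp: bipoly_eval_def)
    then have "coeff ?Q i = 0" by simp
    then have "poly (map_poly of_rat (coeff P i)) (of_nat a :: complex) = 0"
      by (simp add: coeff_map_poly)
    also have "of_nat a = (of_rat (of_nat a) :: complex)" by simp
    finally have "(of_rat (poly (coeff P i) (of_nat a)) :: complex) = 0"
      by (simp only: poly_altdef) (simp add: poly_altdef of_rat_sum of_rat_mult of_rat_power coeff_map_poly degree_map_poly)
    then show ?thesis by simp
  qed
  have "coeff P i = 0" for i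
  proof (rule ccontr)
    assume "coeff P i \<noteq> 0"
    from poly_roots_finite[OF this] have "finite (of_nat ` A :: rat set)"
      by (rule finite_subset[rotated]) (auto simp: coeff)
    then show False using assms(1) by (simp add: finite_image_iff inj_on_def)
  qed
  then show ?thesis by (simp add: poly_eq_iff)
qed

lemma infinite_punctured_disc: "\<delta> > 0 \<Longrightarrow> infinite {y::complex. y \<noteq> 0 \<and> norm y < \<delta>}"
proof
  assume \<delta>: "\<delta> > 0" and fin: "finite {y::complex. y \<noteq> 0 \<and> norm y < \<delta>}"
  have "complex_of_real ` {0<..<\<delta>} \<subseteq> {y::complex. y \<noteq> 0 \<and> norm y < \<delta>}" by auto
  then have "finite (complex_of_real ` {0<..<\<delta>})" using fin finite_subset by blast
  then have "finite {0<..<\<delta>}" by (simp add: finite_image_iff inj_on_def)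
  then show False using \<delta> infinite_Ioo by blast
qed

text \<open>Cross-multiplying two rational functions that agree at these points gives a bivariate polynomial
  which vanishes, for infinitely many \<open>a\<close>, at infinitely many \<open>y\<close>; so it is zero.\<close>

lemma ratfun_eqI:
  assumes "infinite A" and pos: "\<And>a. a \<in> A \<Longrightarrow> \<delta> a > (0::real)"
    and "\<And>a y. a \<in> A \<Longrightarrow> y \<noteq> 0 \<Longrightarrow> norm y < \<delta> a \<Longrightarrow>
      \<exists>v::complex. specialises of_rat (of_nat a) y R v \<and> specialises of_rat (of_nat a) y S v"
  shows "R = S"
proof -
  define P where "P = fst (quot_of_fract R) * snd (quot_of_fract S) - fst (quot_of_fract S) * snd (quot_of_fract R)"
  have "P = 0"
  proof (rule bipoly_zeros_imp_0[OF assms(1)])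
    fix a assume a: "a \<in> A"
    have "bipoly_eval of_rat P (of_nat a) y = 0" if "y \<noteq> 0" "norm y < \<delta> a" for y :: complex
      using assms(3)[OF a that]
      by (auto simp: P_def specialises_def ratfun_defined_def ratfun_eval_def field_simps
          is_homD[OF is_hom_bipoly_eval[OF is_hom_of_rat]])
    then have "{y::complex. y \<noteq> 0 \<and> norm y < \<delta> a} \<subseteq> {y. bipoly_eval of_rat P (of_nat a) y = 0}"
      by auto
    with infinite_punctured_disc[OF pos[OF a]] show "infinite {y::complex. bipoly_eval of_rat P (of_nat a) y = 0}"
      using finite_subset by blast
  qed
  then have *: "fst (quot_of_fract R) * snd (quot_of_fract S) = fst (quot_of_fract S) * snd (quot_of_fract R)"
    by (simp add: P_def)
  have "R = Fract (fst (quot_of_fract R)) (snd (quot_of_fract R))" by simp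
  also have "\<dots> = Fract (fst (quot_of_fract S)) (snd (quot_of_fract S))"
    using * by (subst eq_fract) auto
  finally show ?thesis by simp
qed

text \<open>As \<open>s\<close> runs through a right half-plane, \<open>p\<close> to the power \<open>- s\<close> runs through a punctured disc around
  \<open>0\<close>, so two representing functions agree at enough points.\<close>

lemma represents_euler_factors_unique:
  assumes "represents_euler_factors X T R" "represents_euler_factors X T S"
  shows "R = S"
proof -
  have "\<exists>\<delta>>0. \<forall>y::complex. y \<noteq> 0 \<longrightarrow> norm y < \<delta> \<longrightarrow>
      (\<exists>v. specialises of_rat (of_nat p) y R v \<and> specialises of_rat (of_nat p) y S v)"
    if p: "prime p" for p :: nat
  proof -
    have p1: "real p > 1" using prime_gt_1_nat[OF p] by simp
    obtain \<sigma> \<tau> where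
      \<sigma>: "\<And>s. Re s > \<sigma> \<Longrightarrow> specialises of_rat (of_nat p) (of_nat p powr - s) R (euler_factor X T p s)"
      and \<tau>: "\<And>s. Re s > \<tau> \<Longrightarrow> specialises of_rat (of_nat p) (of_nat p powr - s) S (euler_factor X T p s)"
      using assms p unfolding represents_euler_factors_def specialises_def by metis
    define \<delta> where "\<delta> = real p powr (- max \<sigma> \<tau>)"
    have "\<exists>v. specialises of_rat (of_nat p) y R v \<and> specialises of_rat (of_nat p) y S v"
      if y: "y \<noteq> 0" "norm y < \<delta>" for y :: complex
    proof -
      \<comment> \<open>Any logarithm of \<open>y\<close> gives the same real part, which decides whether \<open>s\<close> lies in the half-planes.\<close>
      define s where "s = - Ln y / of_real (ln p)"
      have "ln (real p) > 0" using p1 by simp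
      then have ys: "of_nat p powr - s = y"
        using y p1 by (simp add: s_def powr_def Ln_of_nat)
      have "ln (norm y) < - max \<sigma> \<tau> * ln p"
        using y p1 by (metis \<delta>_def ln_less_cancel_iff ln_powr zero_less_norm_iff powr_gt_zero less_trans zero_less_one)
      then have "max \<sigma> \<tau> * ln p < - ln (norm y)" by simp
      then have "max \<sigma> \<tau> < - ln (norm y) / ln p"
        using \<open>ln (real p) > 0\<close> by (simp only: pos_less_divide_eq)
      also have "\<dots> = Re s" using y by (simp add: s_def Re_divide_of_real)
      finally have "Re s > \<sigma>" "Re s > \<tau>" by auto
      from \<sigma>[OF this(1)] \<tau>[OF this(2)] show ?thesis unfolding ys by blast
    qed
    moreover have "\<delta> > 0" using p1 by (simp add: \<delta>_def)
    ultimately show ?thesis by blast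
  qed
  then obtain \<delta> where "\<And>p. prime p \<Longrightarrow> \<delta> p > 0"
    "\<And>p y. prime p \<Longrightarrow> y \<noteq> 0 \<Longrightarrow> norm y < \<delta> p \<Longrightarrow>
      \<exists>v::complex. specialises of_rat (of_nat p) y R v \<and> specialises of_rat (of_nat p) y S v"
    by metis
  then show ?thesis
    using primes_infinite by (intro ratfun_eqI[of "{p. prime p}" \<delta>]) auto
qed

section \<open>The rational function attached to a partition\<close>

text \<open>A polynomial in \<open>q\<close> over the ground field containing \<open>x\<close>. For \<open>x = p\<close>, its value at \<open>q = p\<^sup>k\<close>
  divided by its value at \<open>q = 1\<close> is a product of Gaussian binomial coefficients, one for each part of \<open>lam\<close>.\<close>

definition qpoly :: "nat list \<Rightarrow> 'k::comm_ring_1 \<Rightarrow> 'k poly" where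
  "qpoly lam x = prod_list (map (\<lambda>r. \<Prod>j=1..r. [:-1, x ^ j:]) lam)"

lemma poly_qpoly: "poly (qpoly lam x) q = prod_list (map (\<lambda>r. \<Prod>j=1..r. (x ^ j * q - 1)) lam)"
  by (induction lam) (simp_all add: qpoly_def poly_prod algebra_simps)

lemma degree_qpoly: "degree (qpoly lam x) \<le> sum_list lam"
proof (induction lam)
  case (Cons r lam)
  have "degree (\<Prod>j=1..r. [:-1, x ^ j:]) \<le> (\<Sum>j=1..r. degree [:-1, x ^ j:])"
    using degree_prod_sum_le[of "{1..r}" "\<lambda>j. [:-1, x ^ j:]"] by (simp add: o_def)
  also have "\<dots> \<le> (\<Sum>j=1..r. 1)" by (intro sum_mono) simp
  finally have "degree (\<Prod>j=1..r. [:-1, x ^ j:]) \<le> r" by simp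
  with Cons show ?case
    using degree_mult_le[of "\<Prod>j=1..r. [:-1, x ^ j:]" "qpoly lam x"]
    by (simp add: qpoly_def)
qed (simp add: qpoly_def)

text \<open>With \<open>u = y / x\<close> and \<open>g = qpoly lam x\<close>, this is the closed form of \<open>(1 - u) / g(1)\<close> times the
  sum of \<open>g(x\<^sup>k) u\<^sup>k\<close> over \<open>k \<ge> 0\<close>, obtained by summing one geometric series for each coefficient of \<open>g\<close>.
  It makes sense in every field: for rational functions it is the function \<open>R\<close> to be
  found, and for complex numbers it gives the values of \<open>R\<close> and of its inversion.\<close>

definition euler_expr :: "nat list \<Rightarrow> 'k::field \<Rightarrow> 'k \<Rightarrow> 'k" where
  "euler_expr lam x y = (1 - y / x) / poly (qpoly lam x) 1 *
     (\<Sum>e\<le>sum_list lam. coeff (qpoly lam x) e / (1 - x ^ e * (y / x)))"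

lemma specialises_coeff_mult:
  assumes c: "is_hom c"
    and "\<And>i. specialises c x y (coeff P i) (coeff P' i)" "\<And>i. specialises c x y (coeff Q i) (coeff Q' i)"
  shows "specialises c x y (coeff (P * Q) i) (coeff (P' * Q') i)"
  unfolding coeff_mult using assms
  by (intro specialises_sum[OF c] specialises_mult[OF c])

lemma specialises_coeff_qpoly:
  assumes c: "is_hom c"
  shows "specialises c x y (coeff (qpoly lam X_ratfun) i) (coeff (qpoly lam x) i)"
proof -
  have lin: "specialises c x y (coeff [:-1, X_ratfun ^ j:] i) (coeff [:-1, x ^ j:] i)" for i j
    by (cases i; cases "i - 1")
       (auto simp: coeff_pCons intro!: specialises_uminus specialises_1 specialises_0
          specialises_power specialises_X c)
  have "specialises c x y (coeff (\<Prod>j=1..r. [:-1, X_ratfun ^ j:]) i) (coeff (\<Prod>j=1..r. [:-1, x ^ j:]) i)" for r i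
  proof (induction r arbitrary: i)
    case (Suc r)
    then show ?case
      by (simp only: prod.nat_ivl_Suc' le_add2 Suc_eq_plus1[symmetric] One_nat_def Suc_le_mono le0)
         (intro specialises_coeff_mult c lin)
  qed (simp add: specialises_0[OF c] specialises_1[OF c])
  then show ?thesis
    by (induction lam arbitrary: i) (simp_all add: qpoly_def specialises_0[OF c] specialises_1[OF c] specialises_coeff_mult[OF c])
qed

text \<open>All operations in \<open>euler_expr\<close> commute with specialisation as long as no denominator vanishes.\<close>

lemma specialises_euler_expr:
  assumes c: "is_hom c" and x: "x \<noteq> 0" "\<And>j. j \<ge> 1 \<Longrightarrow> x ^ j \<noteq> 1"
    and y: "\<And>e. e \<le> sum_list lam \<Longrightarrow> x ^ e * (y / x) \<noteq> 1"
  shows "specialises c x y (euler_expr lam X_ratfun Y_ratfun) (euler_expr lam x y)"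
proof -
  note sp = specialises_diff[OF c] specialises_1[OF c] specialises_X[OF c] specialises_Y[OF c]
    specialises_mult[OF c] specialises_divide[OF c] specialises_sum[OF c] specialises_power[OF c]
    specialises_poly[OF c] specialises_coeff_qpoly[OF c]
  have "poly (qpoly lam x) 1 \<noteq> 0"
    using x(2) by (auto simp: poly_qpoly prod_list_zero_iff)
  then show ?thesis
    unfolding euler_expr_def using x(1) y by (intro sp) auto
qed

lemma poly_eq_sum_atMost:
  fixes f :: "'a::comm_semiring_1 poly"
  shows "degree f \<le> N \<Longrightarrow> poly f x = (\<Sum>e\<le>N. coeff f e * x ^ e)"
  by (subst poly_altdef, intro sum.mono_neutral_left) (auto simp: coeff_eq_0)

lemma poly_powers_sums:
  fixes f :: "complex poly"
  assumes "degree f \<le> N" "\<And>e. e \<le> N \<Longrightarrow> norm (z ^ e * u) < 1"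
  shows "(\<lambda>k. poly f (z ^ k) * u ^ k) sums (\<Sum>e\<le>N. coeff f e / (1 - z ^ e * u))"
proof -
  have "(\<lambda>k. \<Sum>e\<le>N. coeff f e * (z ^ e * u) ^ k) sums (\<Sum>e\<le>N. coeff f e * (1 / (1 - z ^ e * u)))"
    by (intro sums_sum sums_mult geometric_sums assms(2)) auto
  moreover have "(\<Sum>e\<le>N. coeff f e * (z ^ e * u) ^ k) = poly f (z ^ k) * u ^ k" for k
    unfolding poly_eq_sum_atMost[OF assms(1)] sum_distrib_right
    by (intro sum.cong refl) (simp add: power_mult_distrib mult.commute flip: power_mult)
  ultimately show ?thesis by simp
qed

text \<open>The expansion of the same sum after inverting \<open>w = z\<^sup>e * u\<close>: here \<open>1 / (1 - 1/w) = - w / (1 - w)\<close>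
  is expanded in powers of \<open>w\<close>, which shifts the series by one.\<close>

lemma poly_powers_Suc_sums:
  fixes f :: "complex poly"
  assumes "degree f \<le> N" "\<And>e. e \<le> N \<Longrightarrow> norm (z ^ e * u) < 1" "z \<noteq> 0" "u \<noteq> 0"
  shows "(\<lambda>k. - u * (poly f (z ^ Suc k) * u ^ k)) sums (\<Sum>e\<le>N. coeff f e / (1 - 1 / (z ^ e * u)))"
proof -
  have "(\<lambda>k. \<Sum>e\<le>N. coeff f e * (- (z ^ e * u) * (z ^ e * u) ^ k)) sums
      (\<Sum>e\<le>N. coeff f e * (- (z ^ e * u) * (1 / (1 - z ^ e * u))))"
    by (intro sums_sum sums_mult geometric_sums assms(2)) auto
  moreover have "(\<Sum>e\<le>N. coeff f e * (- (z ^ e * u) * (z ^ e * u) ^ k)) = - u * (poly f (z ^ Suc k) * u ^ k)" for k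
  proof -
    have "coeff f e * (- (z ^ e * u) * (z ^ e * u) ^ k) = - u * (coeff f e * (z ^ Suc k) ^ e * u ^ k)" for e
      by (simp add: power_mult_distrib power_add mult_ac flip: power_mult)
    then show ?thesis
      by (simp only: poly_eq_sum_atMost[OF assms(1)] sum_distrib_right sum_distrib_left)
  qed
  moreover have "coeff f e * (- (z ^ e * u) * (1 / (1 - z ^ e * u))) = coeff f e / (1 - 1 / (z ^ e * u))"
    if "e \<le> N" for e
  proof -
    have "z ^ e * u \<noteq> 1" "z ^ e * u \<noteq> 0" using assms(2)[OF that] assms(3,4) by auto
    moreover have "- w * (1 / (1 - w)) = 1 / (1 - 1 / w)" if "w \<noteq> 0" "w \<noteq> 1" for w :: complex
      using that by (simp add: divide_simps) (simp add: algebra_simps)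
    ultimately show ?thesis by simp
  qed
  ultimately show ?thesis by simp
qed

text \<open>Below this bound for \<open>norm y\<close>, the ratios \<open>p\<^sup>e * (y / p)\<close> with \<open>e \<le> sum_list lam\<close> of the geometric
  series in \<open>euler_expr\<close> have norm less than \<open>1\<close>.\<close>

definition conv_radius_bound :: "nat list \<Rightarrow> nat \<Rightarrow> real" where
  "conv_radius_bound lam p = p / real p ^ sum_list lam"

lemma conv_radius_bound_pos: "p > 0 \<Longrightarrow> conv_radius_bound lam p > 0"
  by (simp add: conv_radius_bound_def)

context
  fixes p :: nat and lam :: "nat list" and y u :: complex
  assumes p: "p \<ge> 2" and y: "norm y < conv_radius_bound lam p"
  defines "u \<equiv> y / of_nat p"
begin

lemma norm_small: "e \<le> sum_list lam \<Longrightarrow> norm (of_nat p ^ e * u) < 1"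
proof -
  assume e: "e \<le> sum_list lam"
  have "norm (of_nat p ^ e * u) = real p ^ e * norm u" by (simp add: norm_mult norm_power)
  also have "\<dots> \<le> real p ^ sum_list lam * norm u"
    using p e by (intro mult_right_mono power_increasing) auto
  also have "\<dots> < 1"
    using y p by (simp add: u_def conv_radius_bound_def norm_divide field_simps)
  finally show ?thesis .
qed

lemma power_p_neq_1: "j \<ge> 1 \<Longrightarrow> (of_nat p :: complex) ^ j \<noteq> 1"
  using p by (metis of_nat_power of_nat_1 of_nat_eq_iff power_eq_1_iff One_nat_def Suc_1
      not_less_eq_eq less_eq_Suc_le nat_power_eq_Suc_0_iff order.refl)

lemma specialises_euler_expr_prime:
  "specialises of_rat (of_nat p) y (euler_expr lam X_ratfun Y_ratfun) (euler_expr lam (of_nat p) y)"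
proof (intro specialises_euler_expr is_hom_of_rat)
  fix e assume "e \<le> sum_list lam"
  from norm_small[OF this] show "of_nat p ^ e * (y / of_nat p) \<noteq> 1"
    unfolding u_def by (metis norm_one less_irrefl)
qed (use p power_p_neq_1 in auto)

lemma specialises_invert_euler_expr_prime:
  assumes "y \<noteq> 0"
  shows "specialises of_rat (of_nat p) y (ratfun_invert (euler_expr lam X_ratfun Y_ratfun))
    (euler_expr lam (inverse (of_nat p)) (inverse y))"
proof (intro specialises_ratfun_invert specialises_euler_expr is_hom_of_rat)
  fix e assume "e \<le> sum_list lam"
  from norm_small[OF this] show "inverse (of_nat p) ^ e * (inverse y / inverse (of_nat p)) \<noteq> 1"
    using p assms by (auto simp: u_def field_simps)
qed (use p assms power_p_neq_1 in \<open>auto simp: field_simps\<close>)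

lemma qpoly_sums:
  obtains S where "(\<lambda>k. poly (qpoly lam (of_nat p)) (of_nat p ^ k) * u ^ k) sums S"
    "euler_expr lam (of_nat p) y = (1 - u) / poly (qpoly lam (of_nat p)) 1 * S"
  using poly_powers_sums[OF degree_qpoly[of lam "of_nat p"] norm_small]
  by (simp add: euler_expr_def u_def)

text \<open>The inverted function, as a power series in the original small quantity \<open>u\<close>. Its prefactor \<open>1 - 1/u\<close> and
  the factor \<open>- u\<close> from \<open>poly_powers_Suc_sums\<close> combine to the same \<open>1 - u\<close> as before inversion.\<close>

lemma qpoly_inverse_sums:
  assumes "y \<noteq> 0"
  obtains S where "(\<lambda>k. poly (qpoly lam (inverse (of_nat p))) (of_nat p ^ Suc k) * u ^ k) sums S"
    "euler_expr lam (inverse (of_nat p)) (inverse y) =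
       (1 - u) / poly (qpoly lam (inverse (of_nat p))) 1 * S"
proof
  let ?f = "qpoly lam (inverse (of_nat p :: complex))"
  let ?S = "\<Sum>e\<le>sum_list lam. coeff ?f e / (1 - 1 / (of_nat p ^ e * u))"
  have u: "u \<noteq> 0" using assms p by (simp add: u_def)
  have "(\<lambda>k. - u * (poly ?f (of_nat p ^ Suc k) * u ^ k)) sums ?S"
    using p u by (intro poly_powers_Suc_sums degree_qpoly norm_small) auto
  from sums_mult[OF this, of "- (1 / u)"]
  show "(\<lambda>k. poly ?f (of_nat p ^ Suc k) * u ^ k) sums (- (1 / u) * ?S)"
    using u by (simp add: mult.assoc)
  have 1: "inverse y / inverse (of_nat p) = 1 / u" using p assms by (simp add: u_def field_simps)
  have 2: "inverse (of_nat p) ^ e * (1 / u) = 1 / (of_nat p ^ e * u)" for e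
    by (simp add: field_simps)
  have 3: "1 - 1 / u = (1 - u) * (- (1 / u))" using u by (simp add: field_simps)
  show "euler_expr lam (inverse (of_nat p)) (inverse y) = (1 - u) / poly ?f 1 * (- (1 / u) * ?S)"
    unfolding euler_expr_def 1 2 3 by simp
qed

end

section \<open>Euler factors of product maps\<close>

text \<open>The closed formula for the Gaussian binomial coefficients, with denominators cleared. The sum on the
  left is \<open>subgroup_count (Suc r) (p ^ k)\<close>. Increasing \<open>r\<close> needs the summation over \<open>j\<close>, which is the inner
  induction on \<open>k\<close>: it is the \<open>q\<close>-analogue of the hockey-stick identity.\<close>

lemma sum_subgroup_count_prime_powers:
  fixes p :: nat
  assumes p: "prime p"
  shows "of_nat (\<Sum>j\<le>k. p ^ j * subgroup_count r (p ^ j)) * (\<Prod>j=1..r. of_nat p ^ j - 1) =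
    (\<Prod>j=1..r. of_nat p ^ (k + j) - (1::'k::comm_ring_1))"
proof (induction r arbitrary: k)
  case 0
  have "p ^ j = 1 \<longleftrightarrow> j = 0" for j using p by (auto dest: prime_gt_1_nat)
  then have "(\<Sum>j\<le>k. p ^ j * subgroup_count 0 (p ^ j)) = (\<Sum>j\<le>k. if j = 0 then 1 else 0)"
    by (intro sum.cong) (auto simp: subgroup_count_0)
  then show ?case by simp
next
  case (Suc r)
  let ?q = "of_nat p :: 'k"
  have pos: "p ^ j \<ge> 1" for j using prime_gt_0_nat[OF p] by simp
  define c where "c j = subgroup_count (Suc r) (p ^ j)" for j
  have last: "(\<Prod>j=1..Suc r. f j) = (\<Prod>j=1..r. f j) * f (Suc r)" for f :: "nat \<Rightarrow> 'k"
    by simp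
  have first: "(\<Prod>j=1..Suc r. f j) = f 1 * (\<Prod>j=1..r. f (Suc j))" for f :: "nat \<Rightarrow> 'k"
    by (simp add: prod.atLeast_Suc_atMost prod.shift_bounds_cl_Suc_ivl del: prod.cl_ivl_Suc)
  have IH: "of_nat (c j) * (\<Prod>j=1..r. ?q ^ j - 1) = (\<Prod>i=1..r. ?q ^ (j + i) - 1)" for j
    using Suc[of j] unfolding c_def subgroup_count_Suc[OF pos] sum_divisors_prime_power[OF p] .
  have "of_nat (\<Sum>j\<le>k. p ^ j * c j) * (\<Prod>j=1..Suc r. ?q ^ j - 1) = (\<Prod>j=1..Suc r. ?q ^ (k + j) - 1)"
  proof (induction k)
    case 0
    have "of_nat (c 0) * (\<Prod>j=1..Suc r. ?q ^ j - 1) =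
        (of_nat (c 0) * (\<Prod>j=1..r. ?q ^ j - 1)) * (?q ^ Suc r - 1)"
      unfolding last by (simp only: mult.assoc)
    also have "\<dots> = (\<Prod>j=1..Suc r. ?q ^ j - 1)" unfolding IH last by simp
    finally show ?case by simp
  next
    case (Suc k)
    have "of_nat (\<Sum>j\<le>Suc k. p ^ j * c j) * (\<Prod>j=1..Suc r. ?q ^ j - 1) =
        of_nat (\<Sum>j\<le>k. p ^ j * c j) * (\<Prod>j=1..Suc r. ?q ^ j - 1) +
        ?q ^ Suc k * (of_nat (c (Suc k)) * (\<Prod>j=1..r. ?q ^ j - 1)) * (?q ^ Suc r - 1)"
      unfolding last by (simp add: algebra_simps)
    also have "\<dots> = (?q ^ Suc k - 1) * (\<Prod>i=1..r. ?q ^ (Suc k + i) - 1) +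
        ?q ^ Suc k * (\<Prod>i=1..r. ?q ^ (Suc k + i) - 1) * (?q ^ Suc r - 1)"
      unfolding Suc IH unfolding first by simp
    also have "\<dots> = (\<Prod>i=1..r. ?q ^ (Suc k + i) - 1) * (?q ^ (Suc k + Suc r) - 1)"
      by (simp add: algebra_simps power_add)
    also have "\<dots> = (\<Prod>j=1..Suc r. ?q ^ (Suc k + j) - 1)" unfolding last ..
    finally show ?case .
  qed
  then show ?case by (simp only: c_def)
qed

locale realisation =
  fixes X :: "nat \<Rightarrow> 'a set" and T :: "nat \<Rightarrow> 'a \<Rightarrow> 'a"
  assumes realises: "\<And>r. 1 \<le> r \<Longrightarrow> realises_subgroup_count (X r) (T r) r"
begin

lemma maps_to: "1 \<le> r \<Longrightarrow> T r \<in> X r \<rightarrow> X r"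
  using realises by (simp add: realises_subgroup_count_def)

lemma finite_fixed: "1 \<le> r \<Longrightarrow> 1 \<le> n \<Longrightarrow> finite (fixed_points (X r) (T r) n)"
  using realises by (intro finite_fixed_points maps_to) (auto simp: realises_subgroup_count_def)

lemma card_fixed_points_prime_power:
  assumes r: "1 \<le> r" and p: "prime p"
  shows "of_nat (card (fixed_points (X r) (T r) (p ^ k))) * (\<Prod>j=1..r. of_nat p ^ j - 1) =
    (\<Prod>j=1..r. of_nat p ^ (k + j) - (1::'k::comm_ring_1))"
proof -
  have pos: "p ^ j \<ge> 1" for j using prime_gt_0_nat[OF p] by simp
  have "card (fixed_points (X r) (T r) (p ^ k)) = (\<Sum>j\<le>k. p ^ j * orbit_count (X r) (T r) (p ^ j))"
    using r pos by (simp only: card_fixed_points[OF maps_to _ finite_fixed] sum_divisors_prime_power[OF p])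
  also have "\<dots> = (\<Sum>j\<le>k. p ^ j * subgroup_count r (p ^ j))"
    using realises[OF r] pos by (simp add: realises_subgroup_count_def)
  finally show ?thesis using sum_subgroup_count_prime_powers[OF p, where k = k and r = r] by simp
qed

context
  fixes lam :: "nat list" and p :: nat
  assumes lam: "\<And>r. r \<in> set lam \<Longrightarrow> 1 \<le> r" and p: "prime p"
begin

lemma finite_fixed_points_product:
  "n \<ge> 1 \<Longrightarrow> finite (fixed_points (product_space X lam) (product_map T lam) n)"
  unfolding fixed_points_product
  by (rule card_listset[THEN conjunct2, rule_format]) (auto intro: finite_fixed lam)

lemma card_fixed_points_product_prime_power:
  "of_nat (card (fixed_points (product_space X lam) (product_map T lam) (p ^ k))) *
     poly (qpoly lam (of_nat p)) 1 = poly (qpoly lam (of_nat p :: 'k::comm_ring_1)) (of_nat p ^ k)"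
proof -
  have "of_nat (card (listset (map (\<lambda>r. fixed_points (X r) (T r) (p ^ k)) mu))) *
      poly (qpoly mu (of_nat p)) 1 = poly (qpoly mu (of_nat p :: 'k)) (of_nat p ^ k)"
    if "\<And>r. r \<in> set mu \<Longrightarrow> 1 \<le> r" for mu
    using that
  proof (induction mu)
    case (Cons r mu)
    have head: "of_nat (card (fixed_points (X r) (T r) (p ^ k))) * (\<Prod>j=1..r. of_nat p ^ j - 1) =
        (\<Prod>j=1..r. of_nat p ^ j * of_nat p ^ k - (1::'k))"
      using Cons.prems by (subst card_fixed_points_prime_power[OF _ p]) (auto simp: power_add mult.commute)
    have IH: "of_nat (card (listset (map (\<lambda>r. fixed_points (X r) (T r) (p ^ k)) mu))) *
      poly (qpoly mu (of_nat p)) 1 = poly (qpoly mu (of_nat p :: 'k)) (of_nat p ^ k)"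
      using Cons by simp
    have card: "card (listset (map (\<lambda>r. fixed_points (X r) (T r) (p ^ k)) (r # mu))) =
        card (fixed_points (X r) (T r) (p ^ k)) * card (listset (map (\<lambda>r. fixed_points (X r) (T r) (p ^ k)) mu))"
      by (simp only: card_listset[THEN conjunct1] list.map prod_list.Cons)
    have poly: "poly (qpoly (r # mu) (of_nat p :: 'k)) q =
        (\<Prod>j=1..r. of_nat p ^ j * q - 1) * poly (qpoly mu (of_nat p)) q" for q
      by (simp add: poly_qpoly)
    have swap: "(a * b) * (c * d) = (a * c) * (b * d)" for a b c d :: 'k by (simp add: mult_ac)
    show ?case
      unfolding card poly of_nat_mult swap IH by (simp only: head mult_1_right)
  qed (simp add: poly_qpoly)
  then show ?thesis unfolding fixed_points_product using lam by blast
qed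

text \<open>The divisors of consecutive powers of \<open>p\<close> differ by a single one, so taking differences inverts the sum over
  divisors in \<open>card_fixed_points\<close>.\<close>

lemma orbit_count_product_prime_power:
  defines "F \<equiv> \<lambda>k. card (fixed_points (product_space X lam) (product_map T lam) (p ^ k))"
  shows "orbit_count (product_space X lam) (product_map T lam) 1 = F 0"
    and "F (Suc k) = F k + p ^ Suc k * orbit_count (product_space X lam) (product_map T lam) (p ^ Suc k)"
proof -
  have pos: "p ^ j \<ge> 1" for j using prime_gt_0_nat[OF p] by simp
  have F: "F k = (\<Sum>j\<le>k. p ^ j * orbit_count (product_space X lam) (product_map T lam) (p ^ j))" for k
  proof -
    have "F k = (\<Sum>d | d dvd p ^ k. d * orbit_count (product_space X lam) (product_map T lam) d)"
      unfolding F_def using pos lam maps_to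
      by (intro card_fixed_points product_map_in_space finite_fixed_points_product) auto
    then show ?thesis by (simp only: sum_divisors_prime_power[OF p])
  qed
  show "orbit_count (product_space X lam) (product_map T lam) 1 = F 0" by (simp add: F)
  show "F (Suc k) = F k + p ^ Suc k * orbit_count (product_space X lam) (product_map T lam) (p ^ Suc k)"
    by (simp add: F)
qed

text \<open>Dividing the orbit count by the period is absorbed in \<open>u = y / p\<close>: the \<open>k\<close>-th term is
  \<open>F k * u ^ k - F (k - 1) * u ^ k\<close>, so the series is \<open>1 - u\<close> times the generating function of \<open>F\<close>.\<close>

lemma orbit_series_sums:
  fixes y :: complex
  assumes y: "norm y < conv_radius_bound lam p"
  shows "(\<lambda>k. of_nat (orbit_count (product_space X lam) (product_map T lam) (p ^ k)) * y ^ k)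
    sums euler_expr lam (of_nat p) y"
proof -
  define u where "u = y / of_nat p"
  define F where "F = (\<lambda>k. card (fixed_points (product_space X lam) (product_map T lam) (p ^ k)))"
  define orb where "orb = (\<lambda>k. orbit_count (product_space X lam) (product_map T lam) (p ^ k))"
  define D where "D = poly (qpoly lam (of_nat p :: complex)) 1"
  have p2: "p \<ge> 2" using prime_ge_2_nat[OF p] .
  have D: "D \<noteq> 0"
    using power_p_neq_1[OF p2 y] by (auto simp: D_def poly_qpoly prod_list_zero_iff)
  obtain S where S: "(\<lambda>k. poly (qpoly lam (of_nat p)) (of_nat p ^ k) * u ^ k) sums S"
    "euler_expr lam (of_nat p) y = (1 - u) / D * S"
    using qpoly_sums[OF p2 y] unfolding u_def D_def by blast
  have "(\<lambda>k. of_nat (F k) * u ^ k) sums (S / D)"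
    using sums_divide[OF S(1), of D] D
    by (simp add: F_def D_def flip: card_fixed_points_product_prime_power)
  note F_sums = this
  have y_eq: "y = of_nat p * u" using p2 by (simp add: u_def)
  have orb_0: "orb 0 = F 0" and orb_Suc: "F (Suc k) = F k + p ^ Suc k * orb (Suc k)" for k
    using orbit_count_product_prime_power by (simp_all add: orb_def F_def)
  have "of_nat (orb (Suc k)) * y ^ Suc k = of_nat (F (Suc k)) * u ^ Suc k - u * (of_nat (F k) * u ^ k)" for k
    unfolding orb_Suc y_eq by (simp add: algebra_simps power_mult_distrib)
  moreover have "(\<lambda>k. of_nat (F (Suc k)) * u ^ Suc k - u * (of_nat (F k) * u ^ k)) sums
      ((S / D - of_nat (F 0) * u ^ 0) - u * (S / D))"
    by (intro sums_diff sums_mult F_sums iffD2[OF sums_Suc_iff[of "\<lambda>k. of_nat (F k) * u ^ k"]])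
      (simp only: diff_add_cancel F_sums)
  ultimately have "(\<lambda>k. of_nat (orb (Suc k)) * y ^ Suc k) sums (S / D - of_nat (F 0) - u * (S / D))"
    by (simp del: power_Suc)
  then have "(\<lambda>k. of_nat (orb k) * y ^ k) sums (S / D - of_nat (F 0) - u * (S / D) + of_nat (orb 0) * y ^ 0)"
    by (rule sums_Suc)
  also have "S / D - of_nat (F 0) - u * (S / D) + of_nat (orb 0) * y ^ 0 = euler_expr lam (of_nat p) y"
    unfolding S(2) orb_0 using D by (simp add: field_simps)
  finally show ?thesis by (simp only: orb_def)
qed

end

lemma represents_euler_expr:
  assumes lam: "\<And>r. r \<in> set lam \<Longrightarrow> 1 \<le> r"
  shows "represents_euler_factors (product_space X lam) (product_map T lam)
    (euler_expr lam X_ratfun Y_ratfun)"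
  unfolding represents_euler_factors_def
proof (intro allI impI)
  fix p :: nat assume p: "prime p"
  have p1: "real p > 1" using prime_gt_1_nat[OF p] by simp
  define \<sigma> where "\<sigma> = - log p (conv_radius_bound lam p)"
  show "\<exists>\<sigma>. \<forall>s. Re s > \<sigma> \<longrightarrow>
      summable (euler_term (product_space X lam) (product_map T lam) p s) \<and>
      ratfun_defined of_rat (euler_expr lam X_ratfun Y_ratfun) (of_nat p) (of_nat p powr - s) \<and>
      euler_factor (product_space X lam) (product_map T lam) p s =
        ratfun_eval of_rat (euler_expr lam X_ratfun Y_ratfun) (of_nat p) (of_nat p powr - s)"
  proof (intro exI[of _ \<sigma>] allI impI)
    fix s :: complex assume s: "Re s > \<sigma>"
    define y where "y = (of_nat p :: complex) powr - s"
    have "norm y = real p powr (- Re s)"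
      using p1 norm_powr_real_powr[of "of_nat p" "- s"] by (simp add: y_def)
    also have "\<dots> < real p powr (log p (conv_radius_bound lam p))"
      using s p1 by (intro powr_less_mono) (simp_all add: \<sigma>_def)
    also have "\<dots> = conv_radius_bound lam p"
      using p1 conv_radius_bound_pos[of p lam] by simp
    finally have y: "norm y < conv_radius_bound lam p" .
    have "(of_nat p :: complex) powr (- of_nat k * s) = y ^ k" for k
      using p1 by (simp add: y_def powr_def exp_of_nat_mult[symmetric] mult_ac)
    then have "euler_term (product_space X lam) (product_map T lam) p s =
        (\<lambda>k. of_nat (orbit_count (product_space X lam) (product_map T lam) (p ^ k)) * y ^ k)"
      by (simp add: euler_term_def fun_eq_iff)
    with orbit_series_sums[OF lam p y]
    have sums: "euler_term (product_space X lam) (product_map T lam) p s sums euler_expr lam (of_nat p) y"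
      by simp
    then show "summable (euler_term (product_space X lam) (product_map T lam) p s) \<and>
      ratfun_defined of_rat (euler_expr lam X_ratfun Y_ratfun) (of_nat p) (of_nat p powr - s) \<and>
      euler_factor (product_space X lam) (product_map T lam) p s =
        ratfun_eval of_rat (euler_expr lam X_ratfun Y_ratfun) (of_nat p) (of_nat p powr - s)"
      using specialises_euler_expr_prime[OF prime_ge_2_nat[OF p] y] sums_unique[OF sums]
      unfolding y_def[symmetric] specialises_def euler_factor_def
      by (auto simp: sums_iff)
  qed
qed

end

lemma (in realisation) euler_ratfun_product:
  assumes "\<And>r. r \<in> set lam \<Longrightarrow> 1 \<le> r"
  shows "euler_ratfun (product_space X lam) (product_map T lam) = euler_expr lam X_ratfun Y_ratfun"
  unfolding euler_ratfun_def
  using represents_euler_expr[OF assms] by (intro the_equality represents_euler_factors_unique)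

section \<open>The functional equation for rectangles\<close>

text \<open>The factor with \<open>j = k + 1\<close> in the block of the part \<open>r\<close> is \<open>1 - 1\<close>.\<close>

lemma qpoly_inverse_eq_0:
  assumes "r \<in> set lam" "k < r" "x \<noteq> (0::'k::field)"
  shows "poly (qpoly lam (inverse x)) (x ^ Suc k) = 0"
proof -
  have "(\<Prod>j=1..r. (inverse x ^ j * x ^ Suc k - 1)) = 0"
    using assms(2,3) by (intro prod_zero bexI[of _ "Suc k"]) (auto simp flip: power_mult_distrib simp del: power_Suc)
  then show ?thesis using assms(1) unfolding poly_qpoly by (force simp: prod_list_zero_iff)
qed

lemma inverse_power_mult: "x \<noteq> (0::'k::field) \<Longrightarrow> j \<le> n \<Longrightarrow> inverse x ^ j * x ^ n = x ^ (n - j)"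
  by (simp add: power_diff power_inverse divide_inverse mult.commute)

lemma qpoly_inverse_above_max:
  assumes "\<And>s. s \<in> set lam \<Longrightarrow> s \<le> r" "x \<noteq> (0::'k::field)"
  shows "poly (qpoly lam (inverse x)) (x ^ Suc (l + r)) =
    prod_list (map (\<lambda>s. \<Prod>j=1..s. (x ^ (l + (Suc r - j)) - 1)) lam)"
proof -
  have "(\<Prod>j=1..s. (inverse x ^ j * x ^ Suc (l + r) - 1)) = (\<Prod>j=1..s. (x ^ (l + (Suc r - j)) - 1))"
    if "s \<in> set lam" for s
    using assms(1)[OF that] assms(2)
    by (intro prod.cong refl) (simp del: power_Suc add: inverse_power_mult)
  then show ?thesis unfolding poly_qpoly by (intro arg_cong[where f = prod_list] map_cong) auto
qed

lemma prod_rev_1: "(\<Prod>j=1..r. f (Suc r - j)) = (\<Prod>j=1..r. f j)"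
  using prod.atLeastAtMost_rev[of f 1 r] by simp

lemma qpoly_inverse_rectangle:
  assumes "x \<noteq> (0::'k::field)"
  shows "poly (qpoly (replicate m r) (inverse x)) (x ^ Suc (l + r)) = poly (qpoly (replicate m r) x) (x ^ l)"
proof -
  have "poly (qpoly (replicate m r) (inverse x)) (x ^ Suc (l + r)) =
      prod_list (map (\<lambda>s. \<Prod>j=1..s. (x ^ (l + (Suc r - j)) - 1)) (replicate m r))"
    using assms by (intro qpoly_inverse_above_max) auto
  then show ?thesis
    unfolding map_replicate prod_list_replicate prod_rev_1[of "\<lambda>j. x ^ (l + j) - 1"] poly_qpoly
    by (simp add: add.commute power_add[symmetric] del: power_Suc)
qed

text \<open>Each factor satisfies \<open>x\<^sup>j - 1 = - x\<^sup>j * (x\<^sup>-\<^sup>j - 1)\<close>, and \<open>1 + \<dots> + r\<close> is \<open>r + 1\<close> choose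
  \<open>2\<close>. This is the source of the sign and of the power of \<open>p\<close> in the functional equation.\<close>

lemma qpoly_inverse_at_1:
  assumes "x \<noteq> (0::'k::field)"
  shows "poly (qpoly lam x) 1 = (-1) ^ sum_list lam * x ^ (\<Sum>r\<leftarrow>lam. Suc r choose 2) * poly (qpoly lam (inverse x)) 1"
proof -
  have "(\<Prod>j=1..r. (x ^ j - 1)) = (-1) ^ r * x ^ (Suc r choose 2) * (\<Prod>j=1..r. (inverse x ^ j - 1))" for r
  proof (induction r)
    case (Suc r)
    have eq: "x ^ Suc r - 1 = (-1) * x ^ Suc r * (inverse x ^ Suc r - 1)"
      using assms by (simp add: field_simps)
    have choose: "Suc (Suc r) choose 2 = (Suc r choose 2) + Suc r"
      by (simp add: numeral_2_eq_2)
    have last: "(\<Prod>j=1..Suc r. f j) = (\<Prod>j=1..r. f j) * f (Suc r)" for f :: "nat \<Rightarrow> 'k"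
      by simp
    show ?case unfolding last Suc eq choose by (simp add: power_add)
  qed (simp add: numeral_2_eq_2)
  then show ?thesis
    by (induction lam) (simp_all add: poly_qpoly power_add)
qed

text \<open>With \<open>u = y / p\<close>, the inverted series vanishes below \<open>u\<^sup>r\<close> and from there on has the same
  coefficients as the original one; the remaining factor compares the two normalisations \<open>g(1)\<close>.\<close>

lemma euler_expr_rectangle:
  fixes p :: nat and y :: complex
  assumes p: "p \<ge> 2" and y: "norm y < conv_radius_bound (replicate m r) p" "y \<noteq> 0" and "m \<ge> 1"
  shows "euler_expr (replicate m r) (inverse (of_nat p)) (inverse y) =
    (-1) ^ (r * m) * of_nat p ^ (m * (Suc r choose 2)) * (y / of_nat p) ^ r *
    euler_expr (replicate m r) (of_nat p) y"
proof -
  let ?lam = "replicate m r" and ?x = "of_nat p :: complex"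
  define u where "u = y / ?x"
  obtain S where S: "(\<lambda>k. poly (qpoly ?lam ?x) (?x ^ k) * u ^ k) sums S"
    "euler_expr ?lam ?x y = (1 - u) / poly (qpoly ?lam ?x) 1 * S"
    using qpoly_sums[OF p y(1)] unfolding u_def by blast
  obtain S' where S': "(\<lambda>k. poly (qpoly ?lam (inverse ?x)) (?x ^ Suc k) * u ^ k) sums S'"
    "euler_expr ?lam (inverse ?x) (inverse y) = (1 - u) / poly (qpoly ?lam (inverse ?x)) 1 * S'"
    using qpoly_inverse_sums[OF p y] unfolding u_def by blast
  have x0: "?x \<noteq> 0" using p by simp
  have "poly (qpoly ?lam (inverse ?x)) (?x ^ Suc k) * u ^ k = 0" if "k < r" for k
    using that x0 \<open>m \<ge> 1\<close> by (subst qpoly_inverse_eq_0[of r]) auto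
  then have "(\<lambda>l. poly (qpoly ?lam (inverse ?x)) (?x ^ Suc (l + r)) * u ^ (l + r)) sums S'"
    using S'(1) by (subst sums_zero_iff_shift) auto
  also have "(\<lambda>l. poly (qpoly ?lam (inverse ?x)) (?x ^ Suc (l + r)) * u ^ (l + r)) =
      (\<lambda>l. u ^ r * (poly (qpoly ?lam ?x) (?x ^ l) * u ^ l))"
    unfolding qpoly_inverse_rectangle[OF x0] by (simp add: power_add mult_ac)
  finally have "S' = u ^ r * S"
    using sums_mult[OF S(1), of "u ^ r"] sums_unique2 by blast
  moreover have "sum_list ?lam = r * m" "(\<Sum>r\<leftarrow>?lam. Suc r choose 2) = m * (Suc r choose 2)"
    by (simp_all add: sum_list_replicate)
  then have D: "poly (qpoly ?lam ?x) 1 =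
      (-1) ^ (r * m) * ?x ^ (m * (Suc r choose 2)) * poly (qpoly ?lam (inverse ?x)) 1"
    using qpoly_inverse_at_1[OF x0, of ?lam] by (simp only:)
  moreover have "poly (qpoly ?lam ?x) 1 \<noteq> 0"
    using power_p_neq_1[OF p y(1)] by (auto simp: poly_qpoly prod_list_zero_iff)
  ultimately show ?thesis
    unfolding S(2) S'(2) u_def[symmetric] D by (simp add: field_simps)
qed

lemma specialises_monomial:
  assumes "x \<noteq> 0" "y \<noteq> (0::complex)"
    and "specialises of_rat x y R v"
  shows "specialises of_rat x y (of_int \<epsilon> * X_ratfun powi d1 * Y_ratfun powi d2 * R)
    (of_int \<epsilon> * x powi d1 * y powi d2 * v)"
  by (intro specialises_mult specialises_of_int specialises_powi specialises_X specialises_Y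
      is_hom_of_rat assms)

text \<open>The numerical identity at \<open>(p, y)\<close> for all primes \<open>p\<close> and all small \<open>y \<noteq> 0\<close> gives the identity
  of rational functions.\<close>

lemma euler_expr_rectangle_functional_equation:
  assumes m: "m \<ge> 1"
  shows "ratfun_invert (euler_expr (replicate m r) X_ratfun Y_ratfun) =
    of_int ((-1) ^ (r * m)) * X_ratfun powi (int m * int (Suc r choose 2) - int r) *
      Y_ratfun powi int r * euler_expr (replicate m r) X_ratfun Y_ratfun"
proof (rule ratfun_eqI[of "{p. prime p}" "conv_radius_bound (replicate m r)"])
  fix p :: nat and y :: complex
  assume "p \<in> {p. prime p}" and y: "y \<noteq> 0" "norm y < conv_radius_bound (replicate m r) p"
  then have p: "p \<ge> 2" by (simp add: prime_ge_2_nat)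
  let ?x = "of_nat p :: complex"
  have "?x powi (int m * int (Suc r choose 2) - int r) * y powi int r =
      ?x ^ (m * (Suc r choose 2)) * (y / ?x) ^ r"
    using p by (simp add: power_int_diff power_divide flip: of_nat_mult)
  then have eq: "euler_expr (replicate m r) (inverse ?x) (inverse y) =
      of_int ((-1) ^ (r * m)) * ?x powi (int m * int (Suc r choose 2) - int r) *
      y powi int r * euler_expr (replicate m r) ?x y"
    using euler_expr_rectangle[OF p y(2,1) m] by (simp add: mult.assoc)
  show "\<exists>v::complex. specialises of_rat ?x y (ratfun_invert (euler_expr (replicate m r) X_ratfun Y_ratfun)) v \<and>
    specialises of_rat ?x y (of_int ((-1) ^ (r * m)) * X_ratfun powi (int m * int (Suc r choose 2) - int r) *
      Y_ratfun powi int r * euler_expr (replicate m r) X_ratfun Y_ratfun) v"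
  proof (intro exI conjI)
    show "specialises of_rat ?x y (ratfun_invert (euler_expr (replicate m r) X_ratfun Y_ratfun))
        (of_int ((-1) ^ (r * m)) * ?x powi (int m * int (Suc r choose 2) - int r) * y powi int r *
         euler_expr (replicate m r) ?x y)"
      unfolding eq[symmetric] by (rule specialises_invert_euler_expr_prime[OF p y(2,1)])
    show "specialises of_rat ?x y (of_int ((-1) ^ (r * m)) * X_ratfun powi (int m * int (Suc r choose 2) - int r) *
        Y_ratfun powi int r * euler_expr (replicate m r) X_ratfun Y_ratfun)
        (of_int ((-1) ^ (r * m)) * ?x powi (int m * int (Suc r choose 2) - int r) * y powi int r *
         euler_expr (replicate m r) ?x y)"
      using p y(1) by (intro specialises_monomial specialises_euler_expr_prime[OF p y(2)]) auto
  qed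
qed (auto simp: primes_infinite prime_gt_0_nat conv_radius_bound_pos)

section \<open>Failure of the functional equation for other partitions\<close>

text \<open>If the exponents differed, cancelling the smaller power would make one of the limits vanish.\<close>

lemma powers_leading_term_unique:
  fixes f g :: "complex \<Rightarrow> complex"
  assumes "(f \<longlongrightarrow> a) (at 0)" "(g \<longlongrightarrow> b) (at 0)" "a \<noteq> 0" "b \<noteq> 0"
    and ev: "eventually (\<lambda>u. u ^ m * f u = u ^ n * g u) (at 0)"
  shows "a = b"
proof -
  have nz: "eventually (\<lambda>u::complex. u \<noteq> 0) (at 0)" by (simp add: eventually_at_filter)
  have not_less: False if less: "i < j" and "(f \<longlongrightarrow> a) (at 0)" "(g \<longlongrightarrow> b) (at 0)" "a \<noteq> 0"
    and ev: "eventually (\<lambda>u. u ^ i * f u = u ^ j * g u) (at 0)"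
    for f g :: "complex \<Rightarrow> complex" and a b i j
  proof -
    have "((\<lambda>u. u ^ (j - i) * g u) \<longlongrightarrow> 0 ^ (j - i) * b) (at 0)"
      by (intro tendsto_intros that)
    moreover have "eventually (\<lambda>u. u ^ (j - i) * g u = f u) (at 0)"
      using ev nz
    proof eventually_elim
      case (elim u)
      then have "u ^ i * f u = u ^ i * (u ^ (j - i) * g u)"
        using less by (simp add: mult.assoc[symmetric] power_add[symmetric])
      with elim show ?case by simp
    qed
    ultimately have "(f \<longlongrightarrow> 0 ^ (j - i) * b) (at 0)" by (rule Lim_transform_eventually)
    then show False using less that(2,4) LIM_unique by fastforce
  qed
  have "m = n"
  proof (cases m n rule: linorder_cases)
    case less
    from not_less[OF this assms(1,2,3) ev] show ?thesis ..
  next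
    case greater
    have "eventually (\<lambda>u. u ^ n * g u = u ^ m * f u) (at 0)" using ev by eventually_elim simp
    from not_less[OF greater assms(2,1,4) this] show ?thesis ..
  qed
  have "eventually (\<lambda>u. f u = g u) (at 0)"
    using ev nz by eventually_elim (simp add: \<open>m = n\<close>)
  then have "(g \<longlongrightarrow> a) (at 0)" using assms(1) Lim_transform_eventually by blast
  then show ?thesis using assms(2) LIM_unique by blast
qed

lemma odd_times_power_2_eq:
  fixes a b :: nat
  assumes "odd a" "odd b" "a * 2 ^ m = b * 2 ^ n"
  shows "a = b"
proof -
  have "coprime (2 ^ m) b" "coprime (2 ^ n) a" using assms by (simp_all add: coprime_commute)
  then have "a dvd b" "b dvd a"
    using assms(3) by (metis coprime_commute coprime_dvd_mult_left_iff dvd_triv_left)+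
  then show ?thesis by (rule dvd_antisym)
qed

text \<open>Reversing the left product gives the factors \<open>2 ^ (s + 1 - j) - 1\<close>, to be compared with
  \<open>2 ^ (r + 1 - j) - 1\<close> for each \<open>j\<close>.\<close>

lemma prod_shifted_ge:
  assumes "s \<le> r"
  shows "(\<Prod>j=1..s. 2 ^ j - 1) \<le> (\<Prod>j=1..s. 2 ^ (Suc r - j) - (1::nat))"
    and "1 \<le> s \<Longrightarrow> s < r \<Longrightarrow> (\<Prod>j=1..s. 2 ^ j - 1) < (\<Prod>j=1..s. 2 ^ (Suc r - j) - (1::nat))"
proof -
  have rev: "(\<Prod>j=1..s. 2 ^ j - 1) = (\<Prod>j=1..s. 2 ^ (Suc s - j) - (1::nat))"
    by (rule prod_rev_1[symmetric])
  show "(\<Prod>j=1..s. 2 ^ j - 1) \<le> (\<Prod>j=1..s. 2 ^ (Suc r - j) - (1::nat))"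
    unfolding rev using assms by (intro prod_mono) (auto intro!: diff_le_mono power_increasing)
  show "(\<Prod>j=1..s. 2 ^ j - 1) < (\<Prod>j=1..s. 2 ^ (Suc r - j) - (1::nat))" if "1 \<le> s" "s < r"
  proof (unfold rev, rule prod_mono_strict[of 1])
    show "2 ^ (Suc s - 1) - 1 < 2 ^ (Suc r - 1) - (1::nat)"
      using that by (intro diff_less_mono power_strict_increasing) auto
    fix i assume i: "i \<in> {1..s}"
    show "0 \<le> 2 ^ (Suc s - i) - (1::nat) \<and> 2 ^ (Suc s - i) - (1::nat) \<le> 2 ^ (Suc r - i) - 1"
      using that by (auto intro!: diff_le_mono power_increasing)
    have "1 < (2::nat) ^ (Suc r - i)" using i that by (intro one_less_power) auto
    then show "0 < 2 ^ (Suc r - i) - (1::nat)" by simp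
  qed (use that in auto)
qed

lemma prod_list_shifted_greater:
  assumes "\<And>s. s \<in> set lam \<Longrightarrow> 1 \<le> s \<and> s \<le> r" "\<exists>s\<in>set lam. s < r"
  shows "prod_list (map (\<lambda>s. \<Prod>j=1..s. 2 ^ j - 1) lam) <
    prod_list (map (\<lambda>s. \<Prod>j=1..s. 2 ^ (Suc r - j) - (1::nat)) lam)"
proof -
  have pos: "0 < prod_list (map (\<lambda>s. \<Prod>j=1..s. 2 ^ j - (1::nat)) lam)" for lam
    by (induction lam) (auto intro!: prod_pos mult_pos_pos one_less_power[of "2::nat", simplified])
  have le: "prod_list (map (\<lambda>s. \<Prod>j=1..s. 2 ^ j - 1) lam) \<le>
      prod_list (map (\<lambda>s. \<Prod>j=1..s. 2 ^ (Suc r - j) - (1::nat)) lam)"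
    if "\<And>s. s \<in> set lam \<Longrightarrow> 1 \<le> s \<and> s \<le> r" for lam
    using that
  proof (induction lam)
    case (Cons s lam)
    then show ?case unfolding list.map prod_list.Cons
      by (intro mult_mono prod_shifted_ge Cons.IH) auto
  qed simp
  show ?thesis
    using assms
  proof (induction lam)
    case (Cons s lam)
    show ?case
    proof (cases "s < r")
      case True
      then show ?thesis unfolding list.map prod_list.Cons
        using Cons.prems pos[of lam] le[of lam] prod_shifted_ge(2)[of s r]
        by (intro mult_less_le_imp_less) auto
    next
      case False
      then show ?thesis unfolding list.map prod_list.Cons
        using Cons pos[of "[s]"] prod_shifted_ge(1)[of s r]
        by (intro mult_le_less_imp_less) auto
    qed
  qed simp
qed

lemma of_nat_prod_list_diff_1:
  fixes lam :: "nat list"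
  assumes "\<And>s j. s \<in> set lam \<Longrightarrow> j \<in> {1..s} \<Longrightarrow> 1 \<le> f s j"
  shows "of_nat (prod_list (map (\<lambda>s. \<Prod>j=1..s. f s j - 1) lam)) =
    prod_list (map (\<lambda>s. \<Prod>j=1..s. (of_nat (f s j) - 1 :: complex)) lam)"
  using assms by (induction lam) (auto simp: of_nat_diff intro!: prod.cong)

lemma odd_prod_list_diff_1:
  fixes lam :: "nat list"
  assumes "\<And>s j. s \<in> set lam \<Longrightarrow> j \<in> {1..s} \<Longrightarrow> 1 \<le> f s j"
  shows "odd (prod_list (map (\<lambda>s. \<Prod>j=1..s. 2 ^ f s j - (1::nat)) lam))"
proof -
  have "odd (\<Prod>j=1..s. 2 ^ f s j - (1::nat))" if "s \<in> set lam" for s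
    using assms[OF that] by (auto simp: even_prod_iff Suc_le_eq)
  then show ?thesis by (induction lam) auto
qed

text \<open>Comparing lowest terms in \<open>u\<close> of both sides of the alleged equation for \<open>p = 2\<close>: on the left this is
  \<open>a 0 = n0\<close> divided by \<open>D'\<close>, on the right \<open>b 0 = m0\<close> divided by \<open>D\<close>, up to \<open>\<epsilon>\<close> and powers of \<open>2\<close>. Since
  \<open>D' = m0\<close> up to sign and a power of \<open>2\<close>, and \<open>b 0 = D = m0\<close>, the odd numbers \<open>n0\<close> and \<open>m0\<close> coincide,
  against \<open>prod_list_shifted_greater\<close>.\<close>

lemma euler_expr_non_rectangle:
  assumes lam: "\<And>s. s \<in> set lam \<Longrightarrow> 1 \<le> s \<and> s \<le> r" "r \<in> set lam" "\<exists>s\<in>set lam. s < r"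
    and fe: "\<And>y::complex. norm y < conv_radius_bound lam 2 \<Longrightarrow> y \<noteq> 0 \<Longrightarrow>
      euler_expr lam (inverse 2) (inverse y) = \<epsilon> * 2 ^ d1 * y ^ d2 * euler_expr lam 2 y"
    and \<epsilon>: "norm \<epsilon> = 1"
  shows False
proof -
  define D D' where "D = poly (qpoly lam (2::complex)) 1" and "D' = poly (qpoly lam (inverse (2::complex))) 1"
  define a where "a = (\<lambda>l. poly (qpoly lam (inverse 2)) ((2::complex) ^ Suc (l + r)))"
  define b where "b = (\<lambda>l. poly (qpoly lam 2) ((2::complex) ^ l))"
  define f g where "f = (\<lambda>u. \<Sum>l. a l * u ^ l)" and "g = (\<lambda>u. \<Sum>l. b l * u ^ l)"
  \<comment> \<open>The variable of the power series is \<open>u = y / 2\<close>.\<close>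
  define \<delta> where "\<delta> = conv_radius_bound lam 2 / 2"
  define n0 m0 :: nat where "n0 = prod_list (map (\<lambda>s. \<Prod>j=1..s. 2 ^ (Suc r - j) - 1) lam)"
    and "m0 = prod_list (map (\<lambda>s. \<Prod>j=1..s. 2 ^ j - 1) lam)"
  have two0: "(2::complex) \<noteq> 0" by simp
  have \<delta>: "\<delta> > 0" by (simp add: \<delta>_def conv_radius_bound_pos)
  have a0: "a 0 = of_nat n0"
    unfolding a_def n0_def using lam(1)
    by (subst qpoly_inverse_above_max[OF _ two0], force, subst of_nat_prod_list_diff_1) auto
  have D: "D = of_nat m0"
    unfolding D_def m0_def poly_qpoly by (subst of_nat_prod_list_diff_1) auto
  have b0: "b 0 = of_nat m0" using D by (simp add: b_def D_def)
  have sm: "norm (2 * u) < conv_radius_bound lam 2" if "norm u < \<delta>" for u :: complex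
    using that by (simp add: \<delta>_def norm_mult)
  have g: "(\<lambda>l. b l * u ^ l) sums g u" "euler_expr lam 2 (2 * u) = (1 - u) / D * g u"
    if u: "norm u < \<delta>" for u
  proof -
    obtain S where S: "(\<lambda>l. b l * u ^ l) sums S" "euler_expr lam 2 (2 * u) = (1 - u) / D * S"
      using qpoly_sums[of 2 "2 * u" lam] sm[OF u] by (auto simp: b_def D_def)
    moreover from S(1) have "S = g u" unfolding g_def by (rule sums_unique)
    ultimately show "(\<lambda>l. b l * u ^ l) sums g u" "euler_expr lam 2 (2 * u) = (1 - u) / D * g u"
      by simp_all
  qed
  have f: "(\<lambda>l. a l * u ^ l) sums f u"
      "euler_expr lam (inverse 2) (inverse (2 * u)) = (1 - u) / D' * (u ^ r * f u)"
    if u: "u \<noteq> 0" "norm u < \<delta>" for u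
  proof -
    obtain S where S: "(\<lambda>k. poly (qpoly lam (inverse 2)) (2 ^ Suc k) * u ^ k) sums S"
        "euler_expr lam (inverse 2) (inverse (2 * u)) = (1 - u) / D' * S"
      using qpoly_inverse_sums[of 2 "2 * u" lam] sm[OF u(2)] u(1)
      by (auto simp: D'_def simp del: power_Suc)
    have "poly (qpoly lam (inverse 2)) (2 ^ Suc k) * u ^ k = 0" if "k < r" for k
      using that lam(2) by (subst qpoly_inverse_eq_0[of r]) auto
    with S(1) have "(\<lambda>l. a l * u ^ (l + r)) sums S"
      unfolding a_def by (subst sums_zero_iff_shift) auto
    from sums_mult[OF this, of "1 / u ^ r"] have s: "(\<lambda>l. a l * u ^ l) sums (1 / u ^ r * S)"
      using u(1) by (simp add: power_add)
    then have "1 / u ^ r * S = f u" unfolding f_def by (rule sums_unique)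
    then have "S = u ^ r * f u" using u(1) by (simp add: field_simps)
    with s S(2) u(1) show "(\<lambda>l. a l * u ^ l) sums f u"
      "euler_expr lam (inverse 2) (inverse (2 * u)) = (1 - u) / D' * (u ^ r * f u)"
      by simp_all
  qed
  define C where "C = \<epsilon> * 2 ^ (d1 + d2) * D'"
  have odd: "odd m0" "odd n0"
    unfolding m0_def n0_def using lam(1) by (intro odd_prod_list_diff_1, fastforce)+
  then have m0: "m0 \<noteq> 0" and "n0 \<noteq> 0" by (auto dest: odd_pos)
  have D_eq: "D = (-1) ^ sum_list lam * 2 ^ (\<Sum>r\<leftarrow>lam. Suc r choose 2) * D'"
    unfolding D_def D'_def by (rule qpoly_inverse_at_1) simp
  with m0 D have D0: "D \<noteq> 0" "D' \<noteq> 0" by auto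
  have "D * a 0 = C * b 0"
  proof (rule powers_leading_term_unique)
    show "((\<lambda>u. D * f u) \<longlongrightarrow> D * a 0) (at 0)"
      using f(1) by (intro tendsto_intros powser_limit_0_strong[OF \<delta>])
    show "((\<lambda>u. C * g u) \<longlongrightarrow> C * b 0) (at 0)"
      using g(1) by (intro tendsto_intros powser_limit_0[OF \<delta>])
    have "u ^ r * (D * f u) = u ^ d2 * (C * g u)" if u: "u \<noteq> 0" "norm u < min \<delta> 1" for u
    proof -
      have "(1 - u) / D' * (u ^ r * f u) = \<epsilon> * 2 ^ d1 * (2 * u) ^ d2 * ((1 - u) / D * g u)"
        using fe[OF sm, of u] f(2)[of u] g(2)[of u] u by simp
      then have "(1 - u) * (u ^ r * (D * f u)) = (1 - u) * (u ^ d2 * (C * g u))"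
        using D0 by (simp add: C_def divide_simps power_add power_mult_distrib mult_ac)
      moreover have "1 - u \<noteq> 0" using u by auto
      ultimately show ?thesis by simp
    qed
    then show "eventually (\<lambda>u. u ^ r * (D * f u) = u ^ d2 * (C * g u)) (at 0)"
      unfolding eventually_at using \<delta> by (intro exI[of _ "min \<delta> 1"]) auto
    show "D * a 0 \<noteq> 0" "C * b 0 \<noteq> 0"
      using D0 m0 \<open>n0 \<noteq> 0\<close> \<epsilon> by (auto simp: a0 b0 C_def)
  qed
  then have "a 0 * D = \<epsilon> * 2 ^ (d1 + d2) * D' * D" by (simp add: C_def b0 D mult.commute)
  then have "a 0 = \<epsilon> * 2 ^ (d1 + d2) * D'" using D0 by simp
  then have "norm (a 0) * 2 ^ (\<Sum>r\<leftarrow>lam. Suc r choose 2) =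
      2 ^ (d1 + d2) * (norm D' * 2 ^ (\<Sum>r\<leftarrow>lam. Suc r choose 2))"
    by (simp add: norm_mult norm_power \<epsilon>)
  also have "norm D' * 2 ^ (\<Sum>r\<leftarrow>lam. Suc r choose 2) = norm D"
    by (simp add: D_eq norm_mult norm_power)
  finally have "real (n0 * 2 ^ (\<Sum>r\<leftarrow>lam. Suc r choose 2)) = real (m0 * 2 ^ (d1 + d2))"
    by (simp add: a0 D mult.commute)
  then have "n0 * 2 ^ (\<Sum>r\<leftarrow>lam. Suc r choose 2) = m0 * 2 ^ (d1 + d2)" by (simp only: of_nat_eq_iff)
  then have "n0 = m0" by (rule odd_times_power_2_eq[OF odd(2,1)])
  moreover have "m0 < n0" unfolding m0_def n0_def using lam by (intro prod_list_shifted_greater) auto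
  ultimately show False by simp
qed

lemma euler_expr_non_rectangle_no_functional_equation:
  assumes lam: "\<And>s. s \<in> set lam \<Longrightarrow> 1 \<le> s" "\<not> is_rectangle lam" and \<epsilon>: "\<epsilon> \<in> {1, - 1::int}"
    and fe: "ratfun_invert (euler_expr lam X_ratfun Y_ratfun) =
      of_int \<epsilon> * X_ratfun powi int d1 * Y_ratfun powi int d2 * euler_expr lam X_ratfun Y_ratfun"
  shows False
proof -
  define r where "r = Max (set lam)"
  have not_replicate: "lam \<noteq> replicate m s" for m s
    using lam(2) unfolding is_rectangle_def by blast
  have "lam \<noteq> []" using not_replicate[of 0] by simp
  then have r: "r \<in> set lam" "\<And>s. s \<in> set lam \<Longrightarrow> s \<le> r" by (auto simp: r_def)
  have "\<exists>s\<in>set lam. s \<noteq> r"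
    using not_replicate[of "length lam" r] replicate_eqI[OF refl, of lam r] by blast
  then have strict: "\<exists>s\<in>set lam. s < r" using r(2) le_neq_implies_less by blast
  show False
  proof (rule euler_expr_non_rectangle[OF _ r(1) strict])
    show "norm (of_int \<epsilon> :: complex) = 1" using \<epsilon> by auto
    fix y :: complex assume y: "norm y < conv_radius_bound lam 2" "y \<noteq> 0"
    have "specialises of_rat (of_nat 2) y (ratfun_invert (euler_expr lam X_ratfun Y_ratfun))
        (of_int \<epsilon> * of_nat 2 powi int d1 * y powi int d2 * euler_expr lam (of_nat 2) y)"
      unfolding fe using y by (intro specialises_monomial specialises_euler_expr_prime) auto
    moreover have "specialises of_rat (of_nat 2) y (ratfun_invert (euler_expr lam X_ratfun Y_ratfun))
        (euler_expr lam (inverse (of_nat 2)) (inverse y))"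
      using y by (intro specialises_invert_euler_expr_prime) auto
    ultimately show "euler_expr lam (inverse 2) (inverse y) = of_int \<epsilon> * 2 ^ d1 * y ^ d2 * euler_expr lam 2 y"
      by (auto dest: specialises_fun)
  qed (use lam(1) r(2) in blast)
qed

section \<open>Functional equations of the Euler factors\<close>

theorem theorem1p3:
  fixes X :: "nat \<Rightarrow> 'a set" and T :: "nat \<Rightarrow> 'a \<Rightarrow> 'a"
  assumes T: "\<And>r. 1 \<le> r \<Longrightarrow> realises_subgroup_count (X r) (T r) r"
  shows "(\<forall>r m :: nat. 1 \<le> r \<and> 1 \<le> m \<longrightarrow>
            euler_functional_equation
              (product_space X (replicate m r)) (product_map T (replicate m r))
              ((- 1) ^ (r * m)) (int m * int ((r + 1) choose 2) - int r) (int r))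
       \<and> (\<forall>lam :: nat list. is_partition lam \<and> \<not> is_rectangle lam \<longrightarrow>
            \<not> (\<exists>\<epsilon>\<in>{1, - 1}. \<exists>d1 d2 :: nat.
                 euler_functional_equation (product_space X lam) (product_map T lam)
                   \<epsilon> (int d1) (int d2)))"
proof (intro conjI allI impI)
  interpret realisation X T by unfold_locales (rule T)
  fix r m :: nat assume rm: "1 \<le> r \<and> 1 \<le> m"
  have eq: "euler_ratfun (product_space X (replicate m r)) (product_map T (replicate m r)) =
      euler_expr (replicate m r) X_ratfun Y_ratfun"
    by (rule euler_ratfun_product) (use rm in auto)
  show "euler_functional_equation
              (product_space X (replicate m r)) (product_map T (replicate m r))
              ((- 1) ^ (r * m)) (int m * int ((r + 1) choose 2) - int r) (int r)"
    unfolding euler_functional_equation_def eq Suc_eq_plus1[symmetric]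
    using rm by (intro euler_expr_rectangle_functional_equation) (rule conjunct2)
next
  interpret realisation X T by unfold_locales (rule T)
  fix lam assume "is_partition lam \<and> \<not> is_rectangle lam"
  then have lam: "\<And>s. s \<in> set lam \<Longrightarrow> 1 \<le> s" "\<not> is_rectangle lam"
    by (simp_all add: is_partition_def)
  have eq: "euler_ratfun (product_space X lam) (product_map T lam) = euler_expr lam X_ratfun Y_ratfun"
    by (rule euler_ratfun_product) (rule lam(1))
  show "\<not> (\<exists>\<epsilon>\<in>{1, - 1}. \<exists>d1 d2 :: nat.
      euler_functional_equation (product_space X lam) (product_map T lam) \<epsilon> (int d1) (int d2))"
  proof
    assume "\<exists>\<epsilon>\<in>{1, - 1}. \<exists>d1 d2 :: nat.
      euler_functional_equation (product_space X lam) (product_map T lam) \<epsilon> (int d1) (int d2)"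
    then obtain \<epsilon> d1 d2 where \<epsilon>: "\<epsilon> \<in> {1, - 1}" and
      fe: "euler_functional_equation (product_space X lam) (product_map T lam) \<epsilon> (int d1) (int d2)"
      by blast
    show False
      by (rule euler_expr_non_rectangle_no_functional_equation[OF _ lam(2) \<epsilon>
            fe[unfolded euler_functional_equation_def eq]]) (rule lam(1))
  qed
qed

end
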